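(* Let $\{W_n\}_{n\ge0}$ be a stationary ergodic Markov chain with state space $(\mathbb S,\mathcal S)$ and invariant initial distribution $m$, whose Markov operator $P$ is normal on $L^2(\mathcal S,m)$ (i.e. $PP^*=P^*P$). Let $f\in L^2(\mathcal S,m)$, put $U_n(f):=\sum_{k=1}^nP^kf$ and $S_n(f):=\sum_{k=1}^nf(W_k)$, and assume that $$\sum_{n\ge1}\frac{\|U_n(f)\|_2^2}{n^2}<+\infty .$$ Then $\{f(W_n)\}$ admits a martingale approximation $\{M_n\}$ for which there is a constant $C>0$ such that, for every $n\ge1$, $$\frac1n\,\|S_n(f)-M_n\|_2^2\le C\Big(\frac1n\sum_{k=1}^n\frac{\|U_k(f)\|_2^2}{k}+\sum_{k\ge n+1}\frac{\|U_k(f)\|_2^2}{k^2}\Big).$$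
   Context: The chain is considered under $\mathbb P_m$, the law of the chain started according to $m$; since $m$ is invariant the chain may be extended to a chain indexed by $\mathbb Z$. $\theta$ denotes the associated shift and $\{\mathcal F_n\}$ the natural filtration. $\|U_n(f)\|_2$ is the norm in $L^2(\mathcal S,m)$ and $\|S_n(f)-M_n\|_2$ the norm in $L^2(\mathbb P_m)$. A stationary process $\{X_n\}$ in $L^2$ with partial sums $S_n=X_1+\dots+X_n$, shift $\theta$ and filtration $\{\mathcal F_n\}$ is said to admit a martingale approximation $\{M_n\}$ if there exists $M\in L^2$ such that $M_n:=\sum_{k=1}^nM\circ\theta^k$ is a martingale with respect to $\{\mathcal F_n\}$ and $\|S_n-M_n\|_2=o(\sqrt n)$. *)

theory Defs
  imports "HOL-Probability.Probability" "HOL-Library.Landau_Symbols"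
begin

text \<open>
  Elements of \<open>L\<^sup>2\<close> are represented by square-integrable functions; equality in \<open>L\<^sup>2\<close> is equality
  almost everywhere.
\<close>

definition L2 :: "'a measure \<Rightarrow> ('a \<Rightarrow> real) set" where
  "L2 M = {f \<in> borel_measurable M. integrable M (\<lambda>x. (f x)\<^sup>2)}"

definition L2_inner :: "'a measure \<Rightarrow> ('a \<Rightarrow> real) \<Rightarrow> ('a \<Rightarrow> real) \<Rightarrow> real" where
  "L2_inner M f g = (\<integral>x. f x * g x \<partial>M)"

definition L2_norm :: "'a measure \<Rightarrow> ('a \<Rightarrow> real) \<Rightarrow> real" where
  "L2_norm M f = sqrt (\<integral>x. (f x)\<^sup>2 \<partial>M)"

definition L2_adjoint ::
  "'a measure \<Rightarrow> (('a \<Rightarrow> real) \<Rightarrow> 'a \<Rightarrow> real) \<Rightarrow> (('a \<Rightarrow> real) \<Rightarrow> 'a \<Rightarrow> real) \<Rightarrow> bool" where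
  "L2_adjoint M T T' \<longleftrightarrow>
     (\<forall>g\<in>L2 M. T' g \<in> L2 M) \<and>
     (\<forall>f\<in>L2 M. \<forall>g\<in>L2 M. L2_inner M (T f) g = L2_inner M f (T' g))"

text \<open>The adjoint is unique up to null sets, so it does not matter which version is taken.\<close>

definition L2_normal :: "'a measure \<Rightarrow> (('a \<Rightarrow> real) \<Rightarrow> 'a \<Rightarrow> real) \<Rightarrow> bool" where
  "L2_normal M T \<longleftrightarrow>
     (\<exists>T'. L2_adjoint M T T' \<and> (\<forall>f\<in>L2 M. AE x in M. T (T' f) x = T' (T f) x))"

text \<open>
  For \<open>f \<in> L\<^sup>2(m)\<close> with \<open>m\<close> invariant, \<open>f\<close> is \<open>K x\<close>-integrable only for \<open>m\<close>-almost every \<open>x\<close>; on the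
  exceptional null set the integral takes the default value 0.
\<close>

definition markov_operator :: "('a \<Rightarrow> 'a measure) \<Rightarrow> ('a \<Rightarrow> real) \<Rightarrow> 'a \<Rightarrow> real" where
  "markov_operator K f x = (\<integral>y. f y \<partial>K x)"

definition U :: "('a \<Rightarrow> 'a measure) \<Rightarrow> ('a \<Rightarrow> real) \<Rightarrow> nat \<Rightarrow> 'a \<Rightarrow> real" where
  "U K f n x = (\<Sum>k=1..n. (markov_operator K ^^ k) f x)"

text \<open>
  The chain indexed by the integers is realised on its path space: \<open>W\<^sub>k\<close> is the coordinate map
  \<open>\<omega> \<mapsto> \<omega> k\<close>.
\<close>

definition path_shift :: "(int \<Rightarrow> 'a) \<Rightarrow> int \<Rightarrow> 'a" where
  "path_shift \<omega> = (\<lambda>k. \<omega> (k + 1))"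

text \<open>\<open>\<F>\<^sub>n = \<sigma>(W\<^sub>k : k \<le> n)\<close>, with \<open>k\<close> ranging over the integers.\<close>

definition natural_filtration :: "'a measure \<Rightarrow> int \<Rightarrow> (int \<Rightarrow> 'a) measure" where
  "natural_filtration S n =
     sigma (space (PiM UNIV (\<lambda>_. S)))
       {(\<lambda>\<omega>. \<omega> k) -` A \<inter> space (PiM UNIV (\<lambda>_. S)) | k A. k \<le> n \<and> A \<in> sets S}"

text \<open>
  The measure \<open>m\<close> carries the state space, \<open>K\<close> is the transition kernel, and \<open>Pm\<close> is the law of the
  two-sided chain. Such a \<open>Pm\<close> is uniquely determined by \<open>m\<close> and \<open>K\<close>.
\<close>

locale stationary_markov_chain =
  fixes m :: "'a measure" and K :: "'a \<Rightarrow> 'a measure" and Pm :: "(int \<Rightarrow> 'a) measure"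
  assumes prob_m: "prob_space m"
    and kernel: "K \<in> m \<rightarrow>\<^sub>M prob_algebra m"
    and invariant: "m \<bind> K = m"
    and prob_Pm: "prob_space Pm"
    and sets_Pm: "sets Pm = sets (PiM UNIV (\<lambda>_. m))"
    and initial: "distr Pm m (\<lambda>\<omega>. \<omega> 0) = m"
    and stationary: "distr Pm Pm path_shift = Pm"
    and markov: "\<And>n A. A \<in> sets m \<Longrightarrow>
      AE \<omega> in Pm. real_cond_exp Pm (natural_filtration m n) (\<lambda>\<omega>. indicator A (\<omega> (n + 1))) \<omega>
        = measure (K (\<omega> n)) A"

locale ergodic_markov_chain = stationary_markov_chain +
  assumes ergodic: "\<And>A. A \<in> sets Pm \<Longrightarrow> path_shift -` A \<inter> space Pm = A \<Longrightarrow>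
    measure Pm A = 0 \<or> measure Pm A = 1"

definition is_martingale ::
  "'w measure \<Rightarrow> (nat \<Rightarrow> 'w measure) \<Rightarrow> (nat \<Rightarrow> 'w \<Rightarrow> real) \<Rightarrow> bool" where
  "is_martingale \<Omega> F X \<longleftrightarrow>
     (\<forall>n. X n \<in> borel_measurable (F n) \<and> integrable \<Omega> (X n)) \<and>
     (\<forall>i j. i \<le> j \<longrightarrow> (AE \<omega> in \<Omega>. real_cond_exp \<Omega> (F i) (X j) \<omega> = X i \<omega>))"

definition shift_sum :: "('w \<Rightarrow> 'w) \<Rightarrow> ('w \<Rightarrow> real) \<Rightarrow> nat \<Rightarrow> 'w \<Rightarrow> real" where
  "shift_sum \<theta> M n \<omega> = (\<Sum>k=1..n. M ((\<theta> ^^ k) \<omega>))"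

definition partial_sum :: "(nat \<Rightarrow> 'w \<Rightarrow> real) \<Rightarrow> nat \<Rightarrow> 'w \<Rightarrow> real" where
  "partial_sum X n \<omega> = (\<Sum>k=1..n. X k \<omega>)"

text \<open>\<open>M\<close> generates a martingale approximation of the process \<open>X\<close>.\<close>

definition martingale_approximation ::
  "'w measure \<Rightarrow> (nat \<Rightarrow> 'w measure) \<Rightarrow> ('w \<Rightarrow> 'w) \<Rightarrow> (nat \<Rightarrow> 'w \<Rightarrow> real) \<Rightarrow> ('w \<Rightarrow> real) \<Rightarrow> bool" where
  "martingale_approximation \<Omega> F \<theta> X M \<longleftrightarrow>
     M \<in> L2 \<Omega> \<and>
     is_martingale \<Omega> F (shift_sum \<theta> M) \<and>
     (\<lambda>n. L2_norm \<Omega> (\<lambda>\<omega>. partial_sum X n \<omega> - shift_sum \<theta> M n \<omega>)) \<in> o(\<lambda>n. sqrt (real n))"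

end

theory Submission
  imports Defs
begin

text \<open>
  Write \<open>P\<close> for the Markov operator, \<open>U\<^sub>n\<close> for \<open>U\<^sub>n(f)\<close>, and
  \<open>R(n) = n\<^sup>-\<^sup>2 \<Sum>\<^sub>k\<^sub>\<le>\<^sub>n \<parallel>U\<^sub>k\<parallel>\<^sup>2 + \<Sum>\<^sub>k\<^sub>>\<^sub>n \<parallel>U\<^sub>k\<parallel>\<^sup>2 / k\<^sup>2\<close>, which is at most the rate claimed
  in the theorem.

  If \<open>f = g - P g\<close>, then \<open>S\<^sub>n(f)\<close> is the martingale with differences \<open>D\<^sub>k(g) = g(W\<^sub>k) - (P g)(W\<^sub>k\<^sub>-\<^sub>1)\<close>
  up to the boundary terms \<open>(P g)(W\<^sub>0) - (P g)(W\<^sub>n)\<close>. In general this equation has no solution, but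
  the Cesaro means \<open>G\<^sub>n\<close> of its Neumann series satisfy \<open>G\<^sub>n - P G\<^sub>n = f - U\<^sub>n / n\<close>
  (\<open>poisson_avg_residual\<close>). With \<open>g = G\<^sub>n\<close>, the boundary terms and the residual contribute
  squared norms of order \<open>n R(n)\<close> to \<open>S\<^sub>n(f)\<close>: the former because \<open>P G\<^sub>n\<close> is the mean of
  \<open>U\<^sub>1, \<dots>, U\<^sub>n\<close>, the latter because \<open>\<parallel>U\<^sub>n\<parallel>\<close> is subadditive in \<open>n\<close> (\<open>orbit_sum_sq_le\<close>).
  It remains to show that \<open>D\<^sub>0(G\<^sub>n)\<close> converges to some \<open>M\<close> with squared error of
  order \<open>R(n)\<close>: the martingales generated by \<open>M\<close> and by \<open>G\<^sub>n\<close> then differ at time \<open>n\<close> by \<open>n\<close> orthogonal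
  terms of that size.

  Now \<open>D\<^sub>0\<close> carries the defect form to the inner product:
  \<open>\<langle>D\<^sub>0(g), D\<^sub>0(h)\<rangle> = \<langle>(I - P\<^sup>*P) g, h\<rangle>\<close>. Instead of the spectral theorem, a single consequence of
  normality is used, \<open>\<parallel>h - P\<^sup>*h\<parallel> = \<parallel>h - P h\<parallel>\<close>, which yields
  \<open>\<langle>(I - P\<^sup>*P) g, h\<rangle> \<le> 2 \<parallel>g\<parallel> \<parallel>h - P h\<parallel>\<close> (\<open>defect_le\<close>). Decompose \<open>G\<^sub>n - G\<^sub>N\<close> into its increments
  between dyadic multiples of \<open>n\<close>. For two increments, put the factor \<open>I - P\<^sup>*P\<close> on the one with the
  larger index: it is small after applying \<open>I - P\<close>, the other one is moderate in norm. So distinct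
  increments are almost orthogonal for the defect form, and the square of the sum is controlled by the
  sum of the squares (\<open>defect_poisson_avg_dyadic\<close>). This is what allows a hypothesis that is
  quadratic in \<open>\<parallel>U\<^sub>n\<parallel>\<close>. The resulting sum over dyadic indices telescopes, because passing from \<open>n\<close> to
  \<open>2 n\<close> decreases \<open>R\<close> by at least a fixed multiple of its first term (\<open>quad_avg_le_rate_drop\<close>), and
  the outcome is the bound \<open>350 R(n)\<close> (\<open>defect_poisson_avg_cauchy\<close>).
\<close>

section \<open>Square-integrable functions\<close>

lemma L2_measurable: "f \<in> L2 M \<Longrightarrow> f \<in> borel_measurable M"
  by (simp add: L2_def)

lemma L2_integrable_sq: "f \<in> L2 M \<Longrightarrow> integrable M (\<lambda>x. (f x)\<^sup>2)"
  by (simp add: L2_def)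

lemma L2_norm_sq: "(L2_norm M f)\<^sup>2 = (\<integral>x. (f x)\<^sup>2 \<partial>M)"
  by (simp add: L2_norm_def)

lemma L2_norm_nonneg [simp]: "0 \<le> L2_norm M f"
  by (simp add: L2_norm_def)

lemma L2_inner_self: "L2_inner M f f = (L2_norm M f)\<^sup>2"
  unfolding L2_norm_sq by (simp add: L2_inner_def power2_eq_square)

lemma L2_inner_commute: "L2_inner M f g = L2_inner M g f"
  by (simp add: L2_inner_def mult.commute)

lemma L2_mult_integrable:
  assumes "f \<in> L2 M" "g \<in> L2 M"
  shows "integrable M (\<lambda>x. f x * g x)"
proof (rule Bochner_Integration.integrable_bound)
  show "integrable M (\<lambda>x. (f x)\<^sup>2 + (g x)\<^sup>2)"
    using assms by (simp add: L2_def)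
  show "(\<lambda>x. f x * g x) \<in> borel_measurable M"
    using assms by (auto simp: L2_def)
  have "\<bar>a * b\<bar> \<le> a\<^sup>2 + b\<^sup>2" for a b :: real
  proof -
    have "2 * \<bar>a * b\<bar> \<le> a\<^sup>2 + b\<^sup>2"
      using sum_squares_bound[of "\<bar>a\<bar>" "\<bar>b\<bar>"] by (simp add: abs_mult)
    then show ?thesis
      using abs_ge_zero[of "a * b"] by linarith
  qed
  then show "AE x in M. norm (f x * g x) \<le> norm ((f x)\<^sup>2 + (g x)\<^sup>2)"
    by (simp add: power2_eq_square)
qed

lemma L2_add:
  assumes "f \<in> L2 M" "g \<in> L2 M"
  shows "(\<lambda>x. f x + g x) \<in> L2 M"
proof -
  have "integrable M (\<lambda>x. (f x)\<^sup>2 + (g x)\<^sup>2 + 2 * (f x * g x))"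
    using assms L2_mult_integrable[OF assms] by (simp add: L2_def)
  moreover have "(f x)\<^sup>2 + (g x)\<^sup>2 + 2 * (f x * g x) = (f x + g x)\<^sup>2" for x
    by (simp add: power2_sum)
  ultimately have "integrable M (\<lambda>x. (f x + g x)\<^sup>2)"
    by simp
  then show ?thesis
    using assms by (auto simp: L2_def)
qed

lemma L2_scale:
  assumes "f \<in> L2 M"
  shows "(\<lambda>x. c * f x) \<in> L2 M"
  using assms by (auto simp: L2_def power_mult_distrib)

lemma L2_divide:
  assumes "f \<in> L2 M"
  shows "(\<lambda>x. f x / c) \<in> L2 M"
  using L2_scale[OF assms, of "1 / c"] by simp

lemma L2_diff:
  assumes "f \<in> L2 M" "g \<in> L2 M"
  shows "(\<lambda>x. f x - g x) \<in> L2 M"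
  using L2_add[OF assms(1) L2_scale[OF assms(2), of "-1"]] by simp

lemma L2_zero: "(\<lambda>x. 0) \<in> L2 M"
  by (simp add: L2_def)

lemma L2_sum:
  assumes "\<And>i. i \<in> I \<Longrightarrow> f i \<in> L2 M"
  shows "(\<lambda>x. \<Sum>i\<in>I. f i x) \<in> L2 M"
  using assms by (induction I rule: infinite_finite_induct) (auto intro: L2_zero L2_add)

lemma L2_norm_AE_cong:
  assumes "f \<in> borel_measurable M" "g \<in> borel_measurable M" "AE x in M. f x = g x"
  shows "L2_norm M f = L2_norm M g"
proof -
  have "(\<integral>x. (f x)\<^sup>2 \<partial>M) = (\<integral>x. (g x)\<^sup>2 \<partial>M)"
    by (rule integral_cong_AE) (use assms in auto)
  then show ?thesis
    by (simp add: L2_norm_def)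
qed

lemma L2_inner_AE_cong:
  assumes "f \<in> borel_measurable M" "f' \<in> borel_measurable M" "AE x in M. f x = f' x"
    and "g \<in> borel_measurable M" "g' \<in> borel_measurable M" "AE x in M. g x = g' x"
  shows "L2_inner M f g = L2_inner M f' g'"
  unfolding L2_inner_def
  by (rule integral_cong_AE) (use assms in auto)

lemma L2_norm_scale_sq: "(L2_norm M (\<lambda>x. c * f x))\<^sup>2 = c\<^sup>2 * (L2_norm M f)\<^sup>2"
  by (simp add: L2_norm_sq power_mult_distrib)

lemma L2_norm_divide_sq: "(L2_norm M (\<lambda>x. f x / c))\<^sup>2 = (L2_norm M f)\<^sup>2 / c\<^sup>2"
  by (simp add: L2_norm_sq power_divide)

lemma L2_norm_minus_commute: "L2_norm M (\<lambda>x. f x - g x) = L2_norm M (\<lambda>x. g x - f x)"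
  by (simp add: L2_norm_def power2_commute)

lemma L2_inner_add_left:
  assumes "f \<in> L2 M" "g \<in> L2 M" "h \<in> L2 M"
  shows "L2_inner M (\<lambda>x. f x + g x) h = L2_inner M f h + L2_inner M g h"
  using assms by (simp add: L2_inner_def L2_mult_integrable distrib_right)

lemma L2_inner_add_right:
  assumes "f \<in> L2 M" "g \<in> L2 M" "h \<in> L2 M"
  shows "L2_inner M h (\<lambda>x. f x + g x) = L2_inner M h f + L2_inner M h g"
  using L2_inner_add_left[OF assms] by (simp add: L2_inner_commute[of M h])

lemma L2_inner_diff_right:
  assumes "f \<in> L2 M" "g \<in> L2 M" "h \<in> L2 M"
  shows "L2_inner M h (\<lambda>x. f x - g x) = L2_inner M h f - L2_inner M h g"
  using assms by (simp add: L2_inner_def L2_mult_integrable right_diff_distrib)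

lemma L2_norm_diff_sq:
  assumes "f \<in> L2 M" "g \<in> L2 M"
  shows "(L2_norm M (\<lambda>x. f x - g x))\<^sup>2
    = (L2_norm M f)\<^sup>2 - 2 * L2_inner M f g + (L2_norm M g)\<^sup>2"
proof -
  have "(f x - g x)\<^sup>2 = (f x)\<^sup>2 - 2 * (f x * g x) + (g x)\<^sup>2" for x
    by (simp add: power2_diff)
  then show ?thesis
    using assms L2_mult_integrable[OF assms] by (simp add: L2_norm_sq L2_inner_def L2_integrable_sq)
qed

lemma L2_norm_add_sq_le:
  assumes "f \<in> L2 M" "g \<in> L2 M"
  shows "(L2_norm M (\<lambda>x. f x + g x))\<^sup>2 \<le> 2 * (L2_norm M f)\<^sup>2 + 2 * (L2_norm M g)\<^sup>2"
proof -
  have "(f x + g x)\<^sup>2 \<le> 2 * (f x)\<^sup>2 + 2 * (g x)\<^sup>2" for x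
    using zero_le_power2[of "f x - g x"] by (simp add: power2_sum power2_diff)
  then have "(\<integral>x. (f x + g x)\<^sup>2 \<partial>M) \<le> (\<integral>x. 2 * (f x)\<^sup>2 + 2 * (g x)\<^sup>2 \<partial>M)"
    using assms L2_add[OF assms] by (intro integral_mono) (auto simp: L2_def)
  then show ?thesis
    using assms by (simp add: L2_norm_sq L2_integrable_sq)
qed

lemma L2_norm_diff_sq_le:
  assumes "f \<in> L2 M" "g \<in> L2 M"
  shows "(L2_norm M (\<lambda>x. f x - g x))\<^sup>2 \<le> 2 * (L2_norm M f)\<^sup>2 + 2 * (L2_norm M g)\<^sup>2"
  using L2_norm_add_sq_le[OF assms(1) L2_scale[OF assms(2), of "-1"]]
    L2_norm_scale_sq[of M "-1" g] by simp

lemma L2_norm_sum_sq_le: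
  assumes "\<And>i. i \<in> I \<Longrightarrow> f i \<in> L2 M"
  shows "(L2_norm M (\<lambda>x. \<Sum>i\<in>I. f i x))\<^sup>2 \<le> real (card I) * (\<Sum>i\<in>I. (L2_norm M (f i))\<^sup>2)"
proof -
  have "(\<Sum>i\<in>I. f i x)\<^sup>2 \<le> real (card I) * (\<Sum>i\<in>I. (f i x)\<^sup>2)" for x
    using Cauchy_Schwarz_ineq_sum[of "\<lambda>_. 1" "\<lambda>i. f i x" I] by simp
  then have "(\<integral>x. (\<Sum>i\<in>I. f i x)\<^sup>2 \<partial>M) \<le> (\<integral>x. real (card I) * (\<Sum>i\<in>I. (f i x)\<^sup>2) \<partial>M)"
    using assms L2_sum[of I f M] by (intro integral_mono) (auto simp: L2_def)
  then show ?thesis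
    using assms by (simp add: L2_norm_sq L2_integrable_sq)
qed

text \<open>
  Cauchy--Schwarz in the weighted arithmetic--geometric form: the weight \<open>c\<close> lets all later
  estimates be carried out with squared norms only.
\<close>

lemma L2_inner_le_weighted:
  assumes "f \<in> L2 M" "g \<in> L2 M" "c > 0"
  shows "2 * L2_inner M f g \<le> (L2_norm M f)\<^sup>2 / c + c * (L2_norm M g)\<^sup>2"
proof -
  have "2 * (f x * g x) \<le> (f x)\<^sup>2 / c + c * (g x)\<^sup>2" for x
  proof -
    have "0 \<le> (f x - c * g x)\<^sup>2 / c"
      using \<open>c > 0\<close> by simp
    also have "\<dots> = (f x)\<^sup>2 / c + c * (g x)\<^sup>2 - 2 * (f x * g x)"
      using \<open>c > 0\<close> by (simp add: field_simps power2_eq_square)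
    finally show ?thesis by simp
  qed
  then have "(\<integral>x. 2 * (f x * g x) \<partial>M) \<le> (\<integral>x. (f x)\<^sup>2 / c + c * (g x)\<^sup>2 \<partial>M)"
    using assms L2_mult_integrable[OF assms(1,2)] by (intro integral_mono) (auto simp: L2_def)
  then show ?thesis
    using assms by (simp add: L2_norm_sq L2_inner_def L2_integrable_sq)
qed

lemma L2_norm_triangle_sq:
  assumes "f \<in> L2 M" "g \<in> L2 M" "h \<in> L2 M"
  shows "(L2_norm M (\<lambda>x. f x - h x))\<^sup>2
    \<le> 2 * (L2_norm M (\<lambda>x. f x - g x))\<^sup>2 + 2 * (L2_norm M (\<lambda>x. g x - h x))\<^sup>2"
  using L2_norm_add_sq_le[OF L2_diff[OF assms(1,2)] L2_diff[OF assms(2,3)]] by simp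

section \<open>Normal contractions\<close>

text \<open>
  Members of \<open>L2\<close> are functions, so an operator on the Hilbert space is a map that respects
  equality almost everywhere and is linear almost everywhere.
\<close>

locale normal_L2_contraction =
  fixes M :: "'a measure" and T :: "('a \<Rightarrow> real) \<Rightarrow> 'a \<Rightarrow> real"
  assumes maps: "f \<in> L2 M \<Longrightarrow> T f \<in> L2 M"
    and AE_cong: "\<lbrakk>f \<in> L2 M; g \<in> L2 M; AE x in M. f x = g x\<rbrakk> \<Longrightarrow> AE x in M. T f x = T g x"
    and add: "\<lbrakk>f \<in> L2 M; g \<in> L2 M\<rbrakk> \<Longrightarrow> AE x in M. T (\<lambda>x. f x + g x) x = T f x + T g x"
    and scale: "f \<in> L2 M \<Longrightarrow> AE x in M. T (\<lambda>x. c * f x) x = c * T f x"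
    and contraction: "f \<in> L2 M \<Longrightarrow> L2_norm M (T f) \<le> L2_norm M f"
    and normal: "L2_normal M T"
begin

lemma diff:
  assumes "f \<in> L2 M" "g \<in> L2 M"
  shows "AE x in M. T (\<lambda>x. f x - g x) x = T f x - T g x"
  using add[OF assms(1) L2_scale[OF assms(2), of "-1"]] scale[OF assms(2), of "-1"] by eventually_elim auto

lemma sum:
  assumes "finite I" "\<And>i. i \<in> I \<Longrightarrow> f i \<in> L2 M"
  shows "AE x in M. T (\<lambda>x. \<Sum>i\<in>I. f i x) x = (\<Sum>i\<in>I. T (f i) x)"
  using assms
proof (induction I)
  case empty
  show ?case
    using scale[OF L2_zero, of 0] by simp
next
  case (insert i I)
  then have "(\<lambda>x. \<Sum>i\<in>I. f i x) \<in> L2 M" "f i \<in> L2 M"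
    by (auto intro: L2_sum)
  from add[OF this(2,1)] insert.IH insert.prems insert.hyps show ?case
    by (auto elim: eventually_elim2)
qed

lemma funpow_L2: "f \<in> L2 M \<Longrightarrow> (T ^^ k) f \<in> L2 M"
  by (induction k) (auto intro: maps)

lemma funpow_contraction: "f \<in> L2 M \<Longrightarrow> L2_norm M ((T ^^ k) f) \<le> L2_norm M f"
  by (induction k) (auto intro: order_trans[OF contraction] funpow_L2)

lemma funpow_sum:
  assumes "finite I" "\<And>i. i \<in> I \<Longrightarrow> f i \<in> L2 M"
  shows "AE x in M. (T ^^ k) (\<lambda>x. \<Sum>i\<in>I. f i x) x = (\<Sum>i\<in>I. (T ^^ k) (f i) x)"
proof (induction k)
  case (Suc k)
  have "AE x in M. T ((T ^^ k) (\<lambda>x. \<Sum>i\<in>I. f i x)) x = T (\<lambda>x. \<Sum>i\<in>I. (T ^^ k) (f i) x) x"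
    using assms by (intro AE_cong Suc.IH funpow_L2 L2_sum)
  moreover have "AE x in M. T (\<lambda>x. \<Sum>i\<in>I. (T ^^ k) (f i) x) x = (\<Sum>i\<in>I. T ((T ^^ k) (f i)) x)"
    using assms by (intro sum funpow_L2)
  ultimately show ?case
    by eventually_elim (simp only: funpow.simps o_apply)
qed simp

text \<open>
  The defect form \<open>\<langle>(I - T\<^sup>*T) f, g\<rangle>\<close>; for a Markov operator it is the inner product of
  martingale differences.
\<close>

definition defect :: "('a \<Rightarrow> real) \<Rightarrow> ('a \<Rightarrow> real) \<Rightarrow> real" where
  "defect f g = L2_inner M f g - L2_inner M (T f) (T g)"

lemma defect_nonneg: "f \<in> L2 M \<Longrightarrow> 0 \<le> defect f f"
  using contraction[of f] by (simp add: defect_def L2_inner_self power_mono)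

lemma defect_add:
  assumes "f \<in> L2 M" "g \<in> L2 M"
  shows "defect (\<lambda>x. f x + g x) (\<lambda>x. f x + g x) = defect f f + 2 * defect f g + defect g g"
proof -
  note [intro] = maps assms L2_add L2_measurable
  have "L2_inner M (T (\<lambda>x. f x + g x)) (T (\<lambda>x. f x + g x))
      = L2_inner M (\<lambda>x. T f x + T g x) (\<lambda>x. T f x + T g x)"
    by (rule L2_inner_AE_cong) (use add[OF assms] in auto)
  then show ?thesis
    unfolding defect_def using assms
    by (simp add: L2_inner_add_left L2_inner_add_right maps L2_add L2_inner_commute[of M g f]
        L2_inner_commute[of M "T g" "T f"])
qed

text \<open>
  The defect form is positive semidefinite, so its diagonal obeys the same quadratic triangle
  inequality as a squared norm.
\<close>

lemma defect_diff_le: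
  assumes "f \<in> L2 M" "g \<in> L2 M" "h \<in> L2 M"
  shows "defect (\<lambda>x. f x - h x) (\<lambda>x. f x - h x)
    \<le> 2 * defect (\<lambda>x. f x - g x) (\<lambda>x. f x - g x) + 2 * defect (\<lambda>x. g x - h x) (\<lambda>x. g x - h x)"
proof -
  define u v where "u = (\<lambda>x. f x - g x)" and "v = (\<lambda>x. g x - h x)"
  have uv: "u \<in> L2 M" "v \<in> L2 M"
    using assms by (auto simp: u_def v_def intro: L2_diff)
  define w where "w = (\<lambda>x. -1 * v x)"
  have w: "w \<in> L2 M"
    unfolding w_def by (rule L2_scale[OF uv(2)])
  have Tw: "AE x in M. T w x = -1 * T v x"
    unfolding w_def by (rule scale[OF uv(2)])
  have inner_w: "L2_inner M a w = - L2_inner M a v" for a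
    by (simp add: L2_inner_def w_def)
  have inner_Tw: "L2_inner M a (T w) = - L2_inner M a (T v)" if "a \<in> L2 M" for a
  proof -
    have "L2_inner M a (T w) = L2_inner M a (\<lambda>x. -1 * T v x)"
      using Tw that uv w by (intro L2_inner_AE_cong) (auto intro!: L2_measurable maps L2_scale)
    then show ?thesis
      by (simp add: L2_inner_def)
  qed
  have uw: "defect u w = - defect u v"
    using uv by (simp add: defect_def inner_w inner_Tw maps)
  have ww: "defect w w = defect v v"
  proof -
    have "L2_norm M (T w) = L2_norm M (\<lambda>x. -1 * T v x)"
      using Tw by (intro L2_norm_AE_cong) (auto intro!: L2_measurable maps L2_scale uv w)
    then show ?thesis
      unfolding defect_def L2_inner_self by (simp add: L2_norm_def w_def)
  qed
  have "0 \<le> defect (\<lambda>x. u x + w x) (\<lambda>x. u x + w x)"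
    by (intro defect_nonneg L2_add uv w)
  then have "2 * defect u v \<le> defect u u + defect v v"
    using defect_add[OF uv(1) w] uw ww by simp
  moreover have "(\<lambda>x. f x - h x) = (\<lambda>x. u x + v x)"
    by (simp add: u_def v_def)
  ultimately show ?thesis
    using defect_add[OF uv] by (simp add: u_def v_def)
qed

text \<open>
  This is the only place where normality enters. Since \<open>T\<close> commutes with its adjoint,
  \<open>\<parallel>T\<^sup>*x\<parallel> = \<parallel>T x\<parallel>\<close> and hence \<open>\<parallel>x - T\<^sup>*x\<parallel> = \<parallel>x - T x\<parallel>\<close>. Writing
  \<open>I - T\<^sup>*T = (I - T) + (I - T\<^sup>*) T\<close>, the whole defect operator can be moved to \<open>g\<close>, where it
  costs at most \<open>2 \<parallel>g - T g\<parallel>\<close>. For a general contraction \<open>\<parallel>x - T\<^sup>*x\<parallel>\<close> is not bounded by a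
  multiple of \<open>\<parallel>x - T x\<parallel>\<close>.
\<close>

lemma defect_le:
  assumes f: "f \<in> L2 M" and g: "g \<in> L2 M" and c: "c > 0"
  shows "2 * defect f g
    \<le> (L2_norm M f)\<^sup>2 / c + 4 * c * (L2_norm M (\<lambda>x. g x - T g x))\<^sup>2"
proof -
  obtain T' where T': "\<And>g. g \<in> L2 M \<Longrightarrow> T' g \<in> L2 M"
    "\<And>f g. \<lbrakk>f \<in> L2 M; g \<in> L2 M\<rbrakk> \<Longrightarrow> L2_inner M (T f) g = L2_inner M f (T' g)"
    "\<And>f. f \<in> L2 M \<Longrightarrow> AE x in M. T (T' f) x = T' (T f) x"
  proof -
    from normal obtain T' where "L2_adjoint M T T'" "\<forall>f\<in>L2 M. AE x in M. T (T' f) x = T' (T f) x"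
      unfolding L2_normal_def by blast
    then show ?thesis
      by (intro that[of T']) (simp_all add: L2_adjoint_def)
  qed
  have same: "(L2_norm M (\<lambda>y. x y - T' x y))\<^sup>2 = (L2_norm M (\<lambda>y. x y - T x y))\<^sup>2"
    if x: "x \<in> L2 M" for x
  proof -
    have "(L2_norm M (T' x))\<^sup>2 = L2_inner M (T' x) (T' x)"
      by (simp add: L2_inner_self)
    also have "\<dots> = L2_inner M (T (T' x)) x"
      using T'(2)[OF T'(1)[OF x] x] by simp
    also have "\<dots> = L2_inner M (T' (T x)) x"
      using T'(3)[OF x] by (intro L2_inner_AE_cong) (auto intro!: L2_measurable maps T' x)
    also have "\<dots> = L2_inner M (T x) (T x)"
      using T'(2)[OF x maps[OF x]] by (simp add: L2_inner_commute)
    finally have "(L2_norm M (T' x))\<^sup>2 = (L2_norm M (T x))\<^sup>2"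
      by (simp add: L2_inner_self)
    moreover have "L2_inner M x (T' x) = L2_inner M x (T x)"
      using T'(2)[OF x x] by (simp add: L2_inner_commute)
    ultimately show ?thesis
      using x T'(1) maps by (simp add: L2_norm_diff_sq)
  qed
  \<comment> \<open>\<open>(I - T\<^sup>*T) g = k + l\<close> with \<open>k = (I - T) g\<close> and \<open>l = (I - T\<^sup>*) T g\<close>.\<close>
  define k where "k = (\<lambda>x. g x - T g x)"
  define l where "l = (\<lambda>x. T g x - T' (T g) x)"
  have k: "k \<in> L2 M" and l: "l \<in> L2 M"
    using g maps T'(1) by (auto simp: k_def l_def intro!: L2_diff)
  have "(L2_norm M l)\<^sup>2 = (L2_norm M (\<lambda>x. T g x - T (T g) x))\<^sup>2"
    unfolding l_def by (rule same[OF maps[OF g]])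
  also have "L2_norm M (\<lambda>x. T g x - T (T g) x) = L2_norm M (T k)"
    unfolding k_def using diff[OF g maps[OF g]]
    by (intro L2_norm_AE_cong) (auto intro!: L2_measurable L2_diff maps g)
  also have "\<dots>\<^sup>2 \<le> (L2_norm M k)\<^sup>2"
    by (intro power_mono contraction k) simp
  finally have lk: "(L2_norm M (\<lambda>x. k x + l x))\<^sup>2 \<le> 4 * (L2_norm M k)\<^sup>2"
    using L2_norm_add_sq_le[OF k l] by linarith
  have "defect f g = L2_inner M f (\<lambda>x. g x - T' (T g) x)"
    using f g T'(2)[OF f maps[OF g]] by (simp add: defect_def L2_inner_diff_right T'(1) maps)
  also have "(\<lambda>x. g x - T' (T g) x) = (\<lambda>x. k x + l x)"
    by (simp add: k_def l_def)
  finally have "2 * defect f g \<le> (L2_norm M f)\<^sup>2 / c + c * (L2_norm M (\<lambda>x. k x + l x))\<^sup>2"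
    using L2_inner_le_weighted[OF f L2_add[OF k l] c] by simp
  moreover have "c * (L2_norm M (\<lambda>x. k x + l x))\<^sup>2 \<le> c * (4 * (L2_norm M k)\<^sup>2)"
    using lk c by (intro mult_left_mono) auto
  ultimately show ?thesis
    by (simp add: k_def)
qed

end

section \<open>Averages and tails of a nonnegative sequence\<close>

text \<open>
  For \<open>b k = \<parallel>U\<^sub>k(f)\<parallel>\<^sup>2\<close> the following three quantities make up the rate of the martingale
  approximation. The average carries \<open>1 / n\<^sup>2\<close> instead of \<open>1 / (n k)\<close>, which makes it smaller; up to
  the mass that enters from the tail, it then shrinks by the factor 4 when \<open>n\<close> doubles.
\<close>

definition quad_avg :: "(nat \<Rightarrow> real) \<Rightarrow> nat \<Rightarrow> real" where
  "quad_avg b n = (\<Sum>k=1..n. b k) / (real n)\<^sup>2"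

definition quad_tail :: "(nat \<Rightarrow> real) \<Rightarrow> nat \<Rightarrow> real" where
  "quad_tail b n = (\<Sum>j. b (j + (n + 1)) / (real (j + (n + 1)))\<^sup>2)"

definition quad_rate :: "(nat \<Rightarrow> real) \<Rightarrow> nat \<Rightarrow> real" where
  "quad_rate b n = quad_avg b n + quad_tail b n"

locale quad_summable =
  fixes b :: "nat \<Rightarrow> real"
  assumes nonneg: "0 \<le> b k"
    and summable: "summable (\<lambda>n. b (Suc n) / (real (Suc n))\<^sup>2)"
begin

lemma summable_from: "summable (\<lambda>j. b (j + (n + 1)) / (real (j + (n + 1)))\<^sup>2)"
  using summable_ignore_initial_segment[OF summable, of n] by simp

lemma quad_avg_nonneg: "0 \<le> quad_avg b n"
  by (simp add: quad_avg_def nonneg sum_nonneg)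

lemma quad_tail_nonneg: "0 \<le> quad_tail b n"
  unfolding quad_tail_def by (intro suminf_nonneg summable_from) (simp add: nonneg)

lemma quad_tail_Suc: "quad_tail b n = b (Suc n) / (real (Suc n))\<^sup>2 + quad_tail b (Suc n)"
  unfolding quad_tail_def using suminf_split_head[OF summable_from[of n]] by simp

lemma quad_tail_diff:
  assumes "n \<le> N"
  shows "quad_tail b n - quad_tail b N = (\<Sum>k=Suc n..N. b k / (real k)\<^sup>2)"
  using assms
proof (induction N rule: dec_induct)
  case (step N)
  then show ?case
    using quad_tail_Suc[of N] by simp
qed simp

text \<open>
  Terms of index at most \<open>N\<close> weigh at least \<open>1 / N\<^sup>2\<close> in the tail, so passing from \<open>n\<close> to \<open>N\<close> moves
  mass from the tail to the average without increasing the total.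
\<close>

lemma quad_avg_step:
  assumes "1 \<le> n" "n \<le> N"
  shows "quad_avg b N
    \<le> (real n / real N)\<^sup>2 * quad_avg b n + (quad_tail b n - quad_tail b N)"
proof -
  have "(\<Sum>k=1..N. b k) = (\<Sum>k=1..n. b k) + (\<Sum>k=Suc n..N. b k)"
    using assms sum.ub_add_nat[of 1 n b "N - n"] by simp
  then have "quad_avg b N = (\<Sum>k=1..n. b k) / (real N)\<^sup>2 + (\<Sum>k=Suc n..N. b k / (real N)\<^sup>2)"
    by (simp add: quad_avg_def add_divide_distrib sum_divide_distrib)
  also have "(\<Sum>k=Suc n..N. b k / (real N)\<^sup>2) \<le> (\<Sum>k=Suc n..N. b k / (real k)\<^sup>2)"
    by (intro sum_mono divide_left_mono) (auto simp: nonneg power_mono intro!: mult_pos_pos)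
  also have "(\<Sum>k=1..n. b k) / (real N)\<^sup>2 = (real n / real N)\<^sup>2 * quad_avg b n"
    using assms by (simp add: quad_avg_def power_divide)
  finally show ?thesis
    using quad_tail_diff[OF assms(2)] by simp
qed

lemma quad_rate_antimono:
  assumes "1 \<le> n" "n \<le> N"
  shows "quad_rate b N \<le> quad_rate b n"
proof -
  have "(real n / real N)\<^sup>2 * quad_avg b n \<le> 1 * quad_avg b n"
    using assms by (intro mult_right_mono quad_avg_nonneg) (simp add: power_le_one)
  then show ?thesis
    using quad_avg_step[OF assms] by (simp add: quad_rate_def)
qed

lemma quad_rate_nonneg: "0 \<le> quad_rate b n"
  by (simp add: quad_rate_def quad_avg_nonneg quad_tail_nonneg)

lemma quad_avg_le_rate:
  assumes "1 \<le> n" "n \<le> N"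
  shows "quad_avg b N \<le> quad_rate b n"
  using quad_rate_antimono[OF assms] quad_tail_nonneg[of N] by (simp add: quad_rate_def)

text \<open>
  For \<open>N = 2 n\<close> the rate loses at least three quarters of the average. Along a dyadic sequence of
  indices the averages are therefore summable, with telescoping bounds.
\<close>

lemma quad_avg_le_rate_drop:
  assumes "1 \<le> n"
  shows "3 * quad_avg b n \<le> 4 * (quad_rate b n - quad_rate b (2 * n))"
proof -
  have "(real n / real (2 * n))\<^sup>2 = 1 / 4"
    using assms by (simp add: power2_eq_square)
  moreover have "quad_avg b (2 * n)
      \<le> (real n / real (2 * n))\<^sup>2 * quad_avg b n + (quad_tail b n - quad_tail b (2 * n))"
    by (rule quad_avg_step) (use assms in auto)
  ultimately have "quad_avg b (2 * n)
      \<le> 1 / 4 * quad_avg b n + (quad_tail b n - quad_tail b (2 * n))"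
    by (simp only:)
  then show ?thesis
    unfolding quad_rate_def by argo
qed

text \<open>
  The rate decreases to some limit, so its drops from \<open>n\<close> to \<open>2 n\<close> vanish in the limit; they dominate
  the averages. The tails vanish by summability.
\<close>

lemma quad_rate_tendsto_0: "quad_rate b \<longlonglongrightarrow> 0"
proof -
  have "decseq (\<lambda>n. quad_rate b (Suc n))"
    by (intro decseq_SucI quad_rate_antimono) auto
  then obtain L where "(\<lambda>n. quad_rate b (Suc n)) \<longlonglongrightarrow> L"
    using decseq_convergent[of "\<lambda>n. quad_rate b (Suc n)" 0] quad_rate_nonneg by blast
  then have L: "quad_rate b \<longlonglongrightarrow> L"
    by (simp add: filterlim_sequentially_Suc)
  have "filterlim (\<lambda>n. 2 * n) sequentially sequentially"
    by (rule filterlim_subseq) (simp add: strict_mono_def)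
  then have "(\<lambda>n. quad_rate b (2 * n)) \<longlonglongrightarrow> L"
    by (rule filterlim_compose[OF L])
  then have "(\<lambda>n. 4 / 3 * (quad_rate b n - quad_rate b (2 * n))) \<longlonglongrightarrow> 4 / 3 * (L - L)"
    by (intro tendsto_intros L)
  then have drop: "(\<lambda>n. 4 / 3 * (quad_rate b n - quad_rate b (2 * n))) \<longlonglongrightarrow> 0"
    by simp
  have avg: "quad_avg b \<longlonglongrightarrow> 0"
  proof (rule tendsto_sandwich[OF _ _ tendsto_const drop])
    show "\<forall>\<^sub>F n in sequentially. 0 \<le> quad_avg b n"
      by (simp add: quad_avg_nonneg)
    show "\<forall>\<^sub>F n in sequentially. quad_avg b n \<le> 4 / 3 * (quad_rate b n - quad_rate b (2 * n))"
      using eventually_ge_at_top[of 1]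
      by eventually_elim (use quad_avg_le_rate_drop in \<open>force simp: field_simps\<close>)
  qed
  have "quad_tail b = (\<lambda>n. \<Sum>j. b (Suc (j + n)) / (real (Suc (j + n)))\<^sup>2)"
    by (simp add: quad_tail_def fun_eq_iff)
  then have "quad_tail b \<longlonglongrightarrow> 0"
    using suminf_exist_split2[OF summable] by simp
  then show ?thesis
    using tendsto_add[OF avg] by (simp add: quad_rate_def[abs_def])
qed

end

section \<open>Averaged solutions of the Poisson equation\<close>

context normal_L2_contraction
begin

definition orbit_sum :: "('a \<Rightarrow> real) \<Rightarrow> nat \<Rightarrow> 'a \<Rightarrow> real" where
  "orbit_sum f n x = (\<Sum>k=1..n. (T ^^ k) f x)"

text \<open>
  An approximate solution of the Poisson equation \<open>g - T g = f\<close>. The formal solution is the Neumann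
  series of \<open>f\<close>, which need not converge; its Cesaro means, the averages of
  \<open>f + T f + \<dots> + T\<^sup>k f\<close> over \<open>k < n\<close>, solve the equation up to the error \<open>U\<^sub>n(f) / n\<close>.
\<close>

definition poisson_avg :: "('a \<Rightarrow> real) \<Rightarrow> nat \<Rightarrow> 'a \<Rightarrow> real" where
  "poisson_avg f n x = f x + (\<Sum>k<n. orbit_sum f k x) / real n"

lemma orbit_sum_L2: "f \<in> L2 M \<Longrightarrow> orbit_sum f n \<in> L2 M"
  unfolding orbit_sum_def[abs_def] by (intro L2_sum funpow_L2)

lemma poisson_avg_L2: "f \<in> L2 M \<Longrightarrow> poisson_avg f n \<in> L2 M"
  unfolding poisson_avg_def[abs_def] by (intro L2_add L2_divide L2_sum orbit_sum_L2)

lemma orbit_sum_split: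
  assumes "f \<in> L2 M" "k \<le> n"
  shows "AE x in M. orbit_sum f n x = orbit_sum f k x + (T ^^ k) (orbit_sum f (n - k)) x"
proof -
  have "AE x in M. (T ^^ k) (orbit_sum f (n - k)) x = (\<Sum>i=1..n-k. (T ^^ k) ((T ^^ i) f) x)"
    unfolding orbit_sum_def[abs_def] by (intro funpow_sum funpow_L2 assms) auto
  moreover have "orbit_sum f n x = orbit_sum f k x + (\<Sum>i=1..n-k. (T ^^ k) ((T ^^ i) f) x)" for x
  proof -
    have "orbit_sum f n x = orbit_sum f k x + (\<Sum>i=k+1..k+(n-k). (T ^^ i) f x)"
      unfolding orbit_sum_def using assms(2) sum.ub_add_nat[of 1 k "\<lambda>i. (T ^^ i) f x" "n - k"] by simp
    also have "(\<Sum>i=k+1..k+(n-k). (T ^^ i) f x) = (\<Sum>i=1..n-k. (T ^^ (i + k)) f x)"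
      using sum.shift_bounds_cl_nat_ivl[of "\<lambda>i. (T ^^ i) f x" 1 k "n - k"] by (simp add: add.commute)
    finally show ?thesis
      by (simp add: funpow_add add.commute[of _ k])
  qed
  ultimately show ?thesis
    by auto
qed

text \<open>
  Because \<open>T\<close> is a contraction, \<open>\<parallel>U\<^sub>n\<parallel>\<close> is subadditive in \<open>n\<close>; hence a single value is
  controlled by the average of the preceding ones.
\<close>

lemma orbit_sum_sq_le:
  assumes f: "f \<in> L2 M"
  shows "(L2_norm M (orbit_sum f n))\<^sup>2
    \<le> 4 * real n * quad_avg (\<lambda>k. (L2_norm M (orbit_sum f k))\<^sup>2) n"
proof -
  define b where "b k = (L2_norm M (orbit_sum f k))\<^sup>2" for k
  \<comment> \<open>This inequality is summed over all \<open>k\<close> between 1 and \<open>n\<close>.\<close>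
  have split: "b n \<le> 2 * b k + 2 * b (n - k)" if "k \<le> n" for k
  proof -
    have "L2_norm M (orbit_sum f n)
        = L2_norm M (\<lambda>x. orbit_sum f k x + (T ^^ k) (orbit_sum f (n - k)) x)"
      using orbit_sum_split[OF f that]
      by (intro L2_norm_AE_cong) (auto intro!: L2_measurable L2_add funpow_L2 orbit_sum_L2 f)
    also have "\<dots>\<^sup>2 \<le> 2 * b k + 2 * (L2_norm M ((T ^^ k) (orbit_sum f (n - k))))\<^sup>2"
      unfolding b_def by (intro L2_norm_add_sq_le funpow_L2 orbit_sum_L2 f)
    also have "(L2_norm M ((T ^^ k) (orbit_sum f (n - k))))\<^sup>2 \<le> b (n - k)"
      unfolding b_def by (intro power_mono funpow_contraction orbit_sum_L2 f) simp
    finally show ?thesis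
      by (simp add: b_def)
  qed
  have b0: "b 0 = 0"
    by (simp add: b_def orbit_sum_def[abs_def] L2_norm_def)
  have "real n * b n = (\<Sum>k=1..n. b n)"
    by simp
  also have "\<dots> \<le> (\<Sum>k=1..n. 2 * b k + 2 * b (n - k))"
    by (intro sum_mono split) auto
  also have "\<dots> = 2 * (\<Sum>k=1..n. b k) + 2 * (\<Sum>k=1..n. b (n - k))"
    by (simp add: sum.distrib sum_distrib_left)
  also have "(\<Sum>k=1..n. b (n - k)) = (\<Sum>k<n. b k)"
    by (rule sum.reindex_bij_witness[of _ "\<lambda>k. n - k" "\<lambda>k. n - k"]) auto
  also have "\<dots> \<le> (\<Sum>k=1..n. b k)"
  proof -
    have "(\<Sum>k<n. b k) \<le> (\<Sum>k\<le>n. b k)"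
      by (intro sum_mono2) (auto simp: b_def)
    also have "\<dots> = (\<Sum>k=1..n. b k)"
      by (simp add: atMost_atLeast0 sum.atLeast_Suc_atMost b0)
    finally show ?thesis .
  qed
  finally have "real n * b n \<le> 4 * (\<Sum>k=1..n. b k)"
    by simp
  then show ?thesis
    unfolding b_def[symmetric] using b0
    by (cases "n = 0") (auto simp: quad_avg_def field_simps power2_eq_square)
qed

lemma T_orbit_sum:
  assumes f: "f \<in> L2 M"
  shows "AE x in M. T f x + T (orbit_sum f k) x = orbit_sum f (Suc k) x"
proof -
  have "AE x in M. orbit_sum f (Suc k) x = orbit_sum f 1 x + (T ^^ 1) (orbit_sum f (Suc k - 1)) x"
    by (rule orbit_sum_split[OF f]) simp
  then show ?thesis
    by eventually_elim (simp add: orbit_sum_def)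
qed

lemma T_poisson_avg:
  assumes f: "f \<in> L2 M" and n: "1 \<le> n"
  shows "AE x in M. T (poisson_avg f n) x = (\<Sum>k=1..n. orbit_sum f k x) / real n"
proof -
  define s where "s x = (\<Sum>k<n. orbit_sum f k x)" for x
  have s: "s \<in> L2 M"
    unfolding s_def[abs_def] by (intro L2_sum orbit_sum_L2 f)
  have "poisson_avg f n = (\<lambda>x. f x + 1 / real n * s x)"
    by (simp add: poisson_avg_def s_def fun_eq_iff)
  then have "AE x in M. T (poisson_avg f n) x = T f x + T (\<lambda>x. 1 / real n * s x) x"
    using add[OF f L2_scale[OF s, of "1 / real n"]] by metis
  moreover have "AE x in M. T (\<lambda>x. 1 / real n * s x) x = 1 / real n * T s x"
    by (rule scale[OF s])
  moreover have "AE x in M. T s x = (\<Sum>k<n. T (orbit_sum f k) x)"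
    unfolding s_def[abs_def] by (intro sum orbit_sum_L2 f) auto
  moreover have "AE x in M. \<forall>k. T f x + T (orbit_sum f k) x = orbit_sum f (Suc k) x"
    using T_orbit_sum[OF f] by (simp add: AE_all_countable)
  ultimately show ?thesis
  proof eventually_elim
    case (elim x)
    have "(\<Sum>k=1..n. orbit_sum f k x) = (\<Sum>k<n. orbit_sum f (Suc k) x)"
      by (rule sum.reindex_bij_witness[of _ Suc "\<lambda>k. k - 1"]) auto
    also have "\<dots> = (\<Sum>k<n. T f x + T (orbit_sum f k) x)"
      using elim(4) by simp
    also have "\<dots> = real n * T f x + T s x"
      by (simp add: sum.distrib elim(3))
    finally show ?case
      using n elim(1,2) by (simp add: field_simps)
  qed
qed

lemma poisson_avg_residual:
  assumes f: "f \<in> L2 M" and n: "1 \<le> n"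
  shows "AE x in M. poisson_avg f n x - T (poisson_avg f n) x = f x - orbit_sum f n x / real n"
  using T_poisson_avg[OF assms]
proof eventually_elim
  case (elim x)
  have "(\<Sum>k=1..n. orbit_sum f k x) = (\<Sum>k\<le>n. orbit_sum f k x)"
    by (simp add: atMost_atLeast0 sum.atLeast_Suc_atMost orbit_sum_def)
  also have "\<dots> = (\<Sum>k<n. orbit_sum f k x) + orbit_sum f n x"
    by (simp add: lessThan_Suc_atMost[symmetric])
  finally show ?case
    using elim by (simp add: poisson_avg_def add_divide_distrib)
qed

end

section \<open>The averaged solutions form a Cauchy sequence for the defect form\<close>

context normal_L2_contraction
begin

abbreviation orbit_sq :: "('a \<Rightarrow> real) \<Rightarrow> nat \<Rightarrow> real" where
  "orbit_sq f k \<equiv> (L2_norm M (orbit_sum f k))\<^sup>2"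

lemma sum_orbit_sq_le:
  assumes "1 \<le> n"
  shows "(\<Sum>k<n. orbit_sq f k) \<le> (real n)\<^sup>2 * quad_avg (orbit_sq f) n"
proof -
  have "orbit_sq f 0 = 0"
    by (simp add: orbit_sum_def[abs_def] L2_norm_def)
  then have "(\<Sum>k\<le>n. orbit_sq f k) = (\<Sum>k=1..n. orbit_sq f k)"
    by (simp add: atMost_atLeast0 sum.atLeast_Suc_atMost)
  moreover have "(\<Sum>k<n. orbit_sq f k) \<le> (\<Sum>k\<le>n. orbit_sq f k)"
    by (intro sum_mono2) auto
  ultimately show ?thesis
    using assms by (simp add: quad_avg_def)
qed

text \<open>
  \<open>f\<close> itself occurs in every average with the same weight, so it cancels in all differences and no
  multiple of \<open>\<parallel>f\<parallel>\<^sup>2\<close>, which need not be bounded by the rate, enters the estimates.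
\<close>

lemma poisson_avg_near:
  assumes f: "f \<in> L2 M" and n: "1 \<le> n"
  shows "(L2_norm M (\<lambda>x. poisson_avg f n x - f x))\<^sup>2 \<le> real n * quad_avg (orbit_sq f) n"
proof -
  have "(L2_norm M (\<lambda>x. poisson_avg f n x - f x))\<^sup>2
      = (L2_norm M (\<lambda>x. \<Sum>k<n. orbit_sum f k x))\<^sup>2 / (real n)\<^sup>2"
    by (simp add: poisson_avg_def L2_norm_divide_sq)
  also have "\<dots> \<le> (real n * (\<Sum>k<n. orbit_sq f k)) / (real n)\<^sup>2"
    using L2_norm_sum_sq_le[of "{..<n}" "orbit_sum f" M] by (intro divide_right_mono) (auto intro: orbit_sum_L2 f)
  also have "\<dots> \<le> (real n * ((real n)\<^sup>2 * quad_avg (orbit_sq f) n)) / (real n)\<^sup>2"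
    by (intro divide_right_mono mult_left_mono sum_orbit_sq_le n) auto
  finally show ?thesis
    using n by simp
qed

lemma poisson_avg_diff_sq_le:
  assumes f: "f \<in> L2 M" and "1 \<le> n" "1 \<le> N"
  shows "(L2_norm M (\<lambda>x. poisson_avg f n x - poisson_avg f N x))\<^sup>2
    \<le> 2 * (real n * quad_avg (orbit_sq f) n) + 2 * (real N * quad_avg (orbit_sq f) N)"
  using L2_norm_triangle_sq[OF poisson_avg_L2[OF f] f poisson_avg_L2[OF f], of n N]
    poisson_avg_near[OF f assms(2)] poisson_avg_near[OF f assms(3)]
    L2_norm_minus_commute[of M f "poisson_avg f N"] by simp

lemma poisson_avg_diff_residual_sq_le:
  assumes f: "f \<in> L2 M" and n: "1 \<le> n" and N: "1 \<le> N"
  defines "h \<equiv> \<lambda>x. poisson_avg f n x - poisson_avg f N x"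
  shows "(L2_norm M (\<lambda>x. h x - T h x))\<^sup>2
    \<le> 8 * (quad_avg (orbit_sq f) n / real n + quad_avg (orbit_sq f) N / real N)"
proof -
  have h: "h \<in> L2 M"
    unfolding h_def by (intro L2_diff poisson_avg_L2 f)
  have scaled: "(L2_norm M (\<lambda>x. orbit_sum f k x / real k))\<^sup>2 \<le> 4 * (quad_avg (orbit_sq f) k / real k)"
    if "1 \<le> k" for k
  proof -
    have "(L2_norm M (\<lambda>x. orbit_sum f k x / real k))\<^sup>2 = orbit_sq f k / (real k)\<^sup>2"
      by (rule L2_norm_divide_sq)
    also have "\<dots> \<le> (4 * real k * quad_avg (orbit_sq f) k) / (real k)\<^sup>2"
      by (intro divide_right_mono orbit_sum_sq_le f) simp
    finally show ?thesis
      using that by (simp add: power2_eq_square)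
  qed
  have "AE x in M. h x - T h x = orbit_sum f N x / real N - orbit_sum f n x / real n"
    using poisson_avg_residual[OF f n] poisson_avg_residual[OF f N]
      diff[OF poisson_avg_L2[OF f] poisson_avg_L2[OF f], of n N, folded h_def]
    by eventually_elim (simp add: h_def)
  then have "L2_norm M (\<lambda>x. h x - T h x)
      = L2_norm M (\<lambda>x. orbit_sum f N x / real N - orbit_sum f n x / real n)"
    by (intro L2_norm_AE_cong L2_measurable L2_diff h maps L2_divide orbit_sum_L2 f)
  then have "(L2_norm M (\<lambda>x. h x - T h x))\<^sup>2
      \<le> 2 * (L2_norm M (\<lambda>x. orbit_sum f N x / real N))\<^sup>2
        + 2 * (L2_norm M (\<lambda>x. orbit_sum f n x / real n))\<^sup>2"
    using L2_norm_diff_sq_le[OF L2_divide[OF orbit_sum_L2[OF f]] L2_divide[OF orbit_sum_L2[OF f]]]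
    by simp
  then show ?thesis
    using scaled[OF n] scaled[OF N] by argo
qed

text \<open>
  Write \<open>G\<^sub>n\<close> for the averaged solution and \<open>A\<close> for the average of squares. The difference
  \<open>G\<^sub>n - G\<^sub>k\<close> has squared norm at most of order \<open>n A(n) + k A(k)\<close>, while \<open>I - T\<close> shrinks the next
  difference, \<open>G\<^sub>N - G\<^sub>N\<^sub>'\<close>, to squared norm of order \<open>(A(N) + A(N')) / N\<close>. The weight \<open>c = N\<close> in the
  bound on the defect form balances the two.
\<close>

lemma defect_poisson_avg_le:
  assumes f: "f \<in> L2 M" and n: "1 \<le> n" and N: "1 \<le> N" "N \<le> N'" and k: "1 \<le> k"
  shows "2 * defect (\<lambda>x. poisson_avg f n x - poisson_avg f k x)
        (\<lambda>x. poisson_avg f N x - poisson_avg f N' x)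
    \<le> 2 * (real n / real N) * quad_avg (orbit_sq f) n + 2 * (real k / real N) * quad_avg (orbit_sq f) k
      + 32 * (quad_avg (orbit_sq f) N + quad_avg (orbit_sq f) N')"
proof -
  let ?A = "quad_avg (orbit_sq f)"
  define u v where "u x = poisson_avg f n x - poisson_avg f k x"
    and "v x = poisson_avg f N x - poisson_avg f N' x" for x
  have uv: "u \<in> L2 M" "v \<in> L2 M"
    unfolding u_def[abs_def] v_def[abs_def] by (intro L2_diff poisson_avg_L2 f)+
  have A: "0 \<le> ?A j" for j
    by (simp add: quad_avg_def sum_nonneg)
  have N0: "real N > 0"
    using N by simp
  have "2 * defect u v
      \<le> (L2_norm M u)\<^sup>2 / real N + 4 * real N * (L2_norm M (\<lambda>x. v x - T v x))\<^sup>2"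
    by (rule defect_le[OF uv N0])
  also have "(L2_norm M u)\<^sup>2 / real N \<le> (2 * (real n * ?A n) + 2 * (real k * ?A k)) / real N"
    unfolding u_def[abs_def] by (intro divide_right_mono poisson_avg_diff_sq_le f n k) simp
  also have "(L2_norm M (\<lambda>x. v x - T v x))\<^sup>2 \<le> 8 * (?A N / real N + ?A N' / real N')"
    unfolding v_def[abs_def] by (intro poisson_avg_diff_residual_sq_le f) (use N in auto)
  also have "8 * (?A N / real N + ?A N' / real N') \<le> 8 * ((?A N + ?A N') / real N)"
  proof -
    have "?A N' / real N' \<le> ?A N' / real N"
      using N A by (intro divide_left_mono) auto
    then show ?thesis
      by (simp add: add_divide_distrib)
  qed
  finally have "2 * defect u v
      \<le> (2 * (real n * ?A n) + 2 * (real k * ?A k)) / real N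
        + 4 * real N * (8 * ((?A N + ?A N') / real N))"
    using N0 by (simp add: mult_left_mono)
  also have "\<dots> = 2 * (real n / real N) * ?A n + 2 * (real k / real N) * ?A k + 32 * (?A N + ?A N')"
    using N0 by (simp add: field_simps)
  finally show ?thesis
    by (simp add: u_def[abs_def] v_def[abs_def])
qed

text \<open>
  The triangle inequality would lead to a sum of square roots of the averages at dyadic indices,
  which need not converge. Expanding the square instead, step \<open>J\<close> contributes at most
  \<open>2 A(n) / 2\<^sup>J + 51 (A(N) + A(2 N))\<close> with \<open>N = n 2\<^sup>J\<close>: the first part is geometric, and the second
  is at most \<open>68 = 51 \<cdot> 4 / 3\<close> times the drop of \<open>R(N) + R(2 N)\<close> from \<open>N\<close> to \<open>2 N\<close>, so it
  telescopes.
\<close>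

lemma defect_poisson_avg_dyadic:
  assumes f: "f \<in> L2 M" and b: "quad_summable (orbit_sq f)" and n: "1 \<le> n"
  defines "R \<equiv> quad_rate (orbit_sq f)" and "A \<equiv> quad_avg (orbit_sq f)"
  shows "defect (\<lambda>x. poisson_avg f n x - poisson_avg f (n * 2 ^ J) x)
        (\<lambda>x. poisson_avg f n x - poisson_avg f (n * 2 ^ J) x)
    \<le> 4 * A n * (1 - 1 / 2 ^ J)
      + 68 * (R n + R (2 * n) - R (n * 2 ^ J) - R (2 * (n * 2 ^ J)))"
proof (induction J)
  case 0
  have "L2_norm M (\<lambda>x. 0) = 0"
    by (simp add: L2_norm_def)
  then show ?case
    by (simp add: defect_def L2_inner_self)
next
  case (Suc J)
  interpret quad_summable "orbit_sq f"
    by (rule b)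
  let ?N = "n * 2 ^ J"
  define N where "N = ?N"
  have N: "1 \<le> N" "n * 2 ^ Suc J = 2 * N"
    using n by (simp_all add: N_def)
  have nN: "real n / real N = 1 / 2 ^ J"
    using n by (simp add: N_def)
  define u v where "u x = poisson_avg f n x - poisson_avg f N x"
    and "v x = poisson_avg f N x - poisson_avg f (2 * N) x" for x
  have uv: "u \<in> L2 M" "v \<in> L2 M"
    unfolding u_def[abs_def] v_def[abs_def] by (intro L2_diff poisson_avg_L2 f)+
  have "(\<lambda>x. poisson_avg f n x - poisson_avg f (2 * N) x) = (\<lambda>x. u x + v x)"
    by (simp add: u_def v_def)
  then have "defect (\<lambda>x. poisson_avg f n x - poisson_avg f (2 * N) x)
      (\<lambda>x. poisson_avg f n x - poisson_avg f (2 * N) x) = defect u u + 2 * defect u v + defect v v"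
    using defect_add[OF uv] by simp
  moreover have "2 * defect u v \<le> 2 * (1 / 2 ^ J) * A n + 2 * A N + 32 * (A N + A (2 * N))"
    using defect_poisson_avg_le[OF f n N(1), of "2 * N" N] N(1)
    unfolding nN A_def u_def[abs_def] v_def[abs_def] by simp
  moreover have "2 * defect v v \<le> 2 * A N + 4 * A (2 * N) + 32 * (A N + A (2 * N))"
    using defect_poisson_avg_le[OF f N(1) N(1), of "2 * N" "2 * N"] N(1)
    unfolding A_def v_def[abs_def] by simp
  moreover have "0 \<le> A (2 * N)"
    unfolding A_def by (rule quad_avg_nonneg)
  moreover have "3 * A N \<le> 4 * (R N - R (2 * N))" "3 * A (2 * N) \<le> 4 * (R (2 * N) - R (2 * (2 * N)))"
    unfolding A_def R_def by (rule quad_avg_le_rate_drop, use N in simp)+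
  moreover have "defect u u \<le> 4 * A n * (1 - 1 / 2 ^ J) + 68 * (R n + R (2 * n) - R N - R (2 * N))"
    using Suc.IH unfolding u_def[abs_def] N_def .
  moreover have "4 * A n * (1 - 1 / 2 ^ J) + 2 * (1 / 2 ^ J) * A n = 4 * A n * (1 - 1 / 2 ^ Suc J)"
    by (simp add: algebra_simps)
  ultimately show ?case
    unfolding N(2) by argo
qed

text \<open>
  Between the last dyadic multiple \<open>m\<close> of \<open>n\<close> and \<open>N\<close> a single step suffices. The constant is
  \<open>2 \<cdot> (4 + 2 \<cdot> 68)\<close> for the dyadic part plus \<open>2 \<cdot> 35\<close> for the last step.
\<close>

lemma defect_poisson_avg_cauchy:
  assumes f: "f \<in> L2 M" and b: "quad_summable (orbit_sq f)" and n: "1 \<le> n" and nN: "n \<le> N"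
  shows "defect (\<lambda>x. poisson_avg f n x - poisson_avg f N x) (\<lambda>x. poisson_avg f n x - poisson_avg f N x)
    \<le> 350 * quad_rate (orbit_sq f) n"
proof -
  interpret quad_summable "orbit_sq f"
    by (rule b)
  let ?A = "quad_avg (orbit_sq f)" and ?R = "quad_rate (orbit_sq f)"
  \<comment> \<open>\<open>n 2\<^sup>J\<close> is the last dyadic multiple of \<open>n\<close> that does not exceed \<open>N\<close>.\<close>
  have "\<exists>J. n * 2 ^ J \<le> N \<and> N < n * 2 ^ Suc J"
  proof -
    have bound: "\<exists>J. N < n * 2 ^ J"
    proof
      have "N < 2 ^ N"
        by (rule less_exp)
      also have "\<dots> \<le> n * 2 ^ N"
        using n by simp
      finally show "N < n * 2 ^ N" .
    qed
    define J where "J = (LEAST J. N < n * 2 ^ J)"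
    have J: "N < n * 2 ^ J"
      unfolding J_def by (rule LeastI_ex[OF bound])
    then have "J \<noteq> 0"
      using nN by (intro notI) simp
    then obtain J' where J': "J = Suc J'"
      using not0_implies_Suc by blast
    then have "\<not> N < n * 2 ^ J'"
      using not_less_Least[of J' "\<lambda>J. N < n * 2 ^ J"] by (simp add: J_def)
    then show ?thesis
      using J J' by (auto intro!: exI[of _ J'])
  qed
  then obtain J where J: "n * 2 ^ J \<le> N" "N < n * 2 ^ Suc J"
    by blast
  define m where "m = n * 2 ^ J"
  have m: "1 \<le> m" "n \<le> m" "m \<le> N" "N \<le> 2 * m"
    using n J by (auto simp: m_def)
  let ?d = "\<lambda>i j. defect (\<lambda>x. poisson_avg f i x - poisson_avg f j x) (\<lambda>x. poisson_avg f i x - poisson_avg f j x)"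
  have pos: "0 \<le> ?A n" "0 \<le> ?A N" "0 \<le> ?R m" "0 \<le> ?R (2 * m)"
    by (rule quad_avg_nonneg quad_rate_nonneg)+
  have "?d n m \<le> 4 * ?A n * (1 - 1 / 2 ^ J) + 68 * (?R n + ?R (2 * n) - ?R m - ?R (2 * m))"
    unfolding m_def by (rule defect_poisson_avg_dyadic[OF f b n])
  moreover have "4 * ?A n * (1 - 1 / 2 ^ J) \<le> 4 * ?A n * 1"
    by (intro mult_left_mono) (use pos in auto)
  moreover have "?R (2 * n) \<le> ?R n"
    by (rule quad_rate_antimono) (use n in auto)
  moreover have "?A n \<le> ?R n" "?A m \<le> ?R n" "?A N \<le> ?R n"
    using n m nN by (auto intro!: quad_avg_le_rate)
  moreover have "2 * ?d m N \<le> 2 * ?A m + 2 * (real N / real m) * ?A N + 32 * (?A m + ?A N)"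
    using defect_poisson_avg_le[OF f m(1) m(1) m(3), of N] m by simp
  moreover have "2 * (real N / real m) * ?A N \<le> 2 * 2 * ?A N"
    using m pos by (intro mult_right_mono mult_left_mono) (auto simp: field_simps)
  moreover have "?d n N \<le> 2 * ?d n m + 2 * ?d m N"
    by (intro defect_diff_le poisson_avg_L2 f)
  ultimately show ?thesis
    using pos by argo
qed

end

section \<open>Completeness of the space of square-integrable functions\<close>

lemma (in prob_space) L2_integrable:
  assumes "f \<in> L2 M"
  shows "integrable M f"
  by (rule square_integrable_imp_integrable) (use assms in \<open>simp_all add: L2_def\<close>)

lemma (in prob_space) integral_abs_le_L2:
  assumes f: "f \<in> L2 M" and e: "e > 0"
  shows "(\<integral>x. \<bar>f x\<bar> \<partial>M) \<le> e / 2 + (L2_norm M f)\<^sup>2 / (2 * e)"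
proof -
  have "\<bar>f x\<bar> \<le> e / 2 + (f x)\<^sup>2 / (2 * e)" for x
  proof -
    have "2 * e * \<bar>f x\<bar> \<le> e\<^sup>2 + (f x)\<^sup>2"
      using sum_squares_bound[of e "\<bar>f x\<bar>"] by simp
    then have "\<bar>f x\<bar> \<le> (e\<^sup>2 + (f x)\<^sup>2) / (2 * e)"
      using e by (simp add: pos_le_divide_eq mult.commute)
    also have "\<dots> = e / 2 + (f x)\<^sup>2 / (2 * e)"
      using e by (simp add: add_divide_distrib power2_eq_square)
    finally show ?thesis .
  qed
  then have "(\<integral>x. \<bar>f x\<bar> \<partial>M) \<le> (\<integral>x. e / 2 + (f x)\<^sup>2 / (2 * e) \<partial>M)"
    using L2_integrable[OF f] L2_integrable_sq[OF f] by (intro integral_mono) auto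
  also have "\<dots> = e / 2 + (L2_norm M f)\<^sup>2 / (2 * e)"
    using L2_integrable_sq[OF f] by (simp add: L2_norm_sq prob_space)
  finally show ?thesis .
qed

text \<open>
  Riesz and Fischer: a Cauchy sequence in \<open>L\<^sup>2\<close> of a probability space is Cauchy in \<open>L\<^sup>1\<close>, so a
  subsequence converges almost everywhere, and Fatou's lemma passes the Cauchy estimates to the limit.
\<close>

lemma (in prob_space) L2_complete:
  assumes X: "\<And>n. X n \<in> L2 M"
    and cauchy: "\<And>e. e > 0 \<Longrightarrow> \<exists>N. \<forall>i\<ge>N. \<forall>j\<ge>N. (L2_norm M (\<lambda>x. X i x - X j x))\<^sup>2 < e"
  obtains Y where "Y \<in> L2 M" "(\<lambda>n. (L2_norm M (\<lambda>x. X n x - Y x))\<^sup>2) \<longlonglongrightarrow> 0"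
proof -
  have [measurable]: "X n \<in> borel_measurable M" for n
    by (rule L2_measurable[OF X])
  have "\<exists>N. \<forall>i\<ge>N. \<forall>j\<ge>N. (\<integral>x. norm (X i x - X j x) \<partial>M) < e" if e: "e > 0" for e
  proof -
    obtain N where N: "(L2_norm M (\<lambda>x. X i x - X j x))\<^sup>2 < e\<^sup>2" if "i \<ge> N" "j \<ge> N" for i j
      using cauchy[of "e\<^sup>2"] e by auto
    have "(\<integral>x. norm (X i x - X j x) \<partial>M) < e" if "i \<ge> N" "j \<ge> N" for i j
    proof -
      have "(L2_norm M (\<lambda>x. X i x - X j x))\<^sup>2 / (2 * e) < e\<^sup>2 / (2 * e)"
        using N[OF that] e by (intro divide_strict_right_mono) auto
      also have "\<dots> = e / 2"
        using e by (simp add: power2_eq_square)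
      finally show ?thesis
        using integral_abs_le_L2[OF L2_diff[OF X X] e, of i j] by simp
    qed
    then show ?thesis
      by blast
  qed
  then obtain r :: "nat \<Rightarrow> nat" where r: "strict_mono r" "AE x in M. Cauchy (\<lambda>i. X (r i) x)"
    using cauchy_L1_AE_cauchy_subseq[of M X] L2_integrable[OF X] by blast
  \<comment> \<open>An arbitrary value on the null set where the subsequence diverges.\<close>
  define Y where "Y x = lim (\<lambda>i. X (r i) x)" for x
  have Y[measurable]: "Y \<in> borel_measurable M"
    unfolding Y_def[abs_def] by measurable
  have lim: "AE x in M. (\<lambda>i. X (r i) x) \<longlonglongrightarrow> Y x"
    using r(2) by eventually_elim (simp add: Y_def Cauchy_convergent convergent_LIMSEQ_iff[symmetric])
  have close: "(\<integral>\<^sup>+x. ennreal ((X n x - Y x)\<^sup>2) \<partial>M) \<le> ennreal e"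
    if N: "\<And>i j. i \<ge> N \<Longrightarrow> j \<ge> N \<Longrightarrow> (L2_norm M (\<lambda>x. X i x - X j x))\<^sup>2 < e" and n: "n \<ge> N" for e n N
  proof -
    have "(\<integral>\<^sup>+x. ennreal ((X n x - Y x)\<^sup>2) \<partial>M)
        = (\<integral>\<^sup>+x. liminf (\<lambda>i. ennreal ((X n x - X (r i) x)\<^sup>2)) \<partial>M)"
    proof (rule nn_integral_cong_AE)
      show "AE x in M. ennreal ((X n x - Y x)\<^sup>2) = liminf (\<lambda>i. ennreal ((X n x - X (r i) x)\<^sup>2))"
        using lim
      proof eventually_elim
        case (elim x)
        then have "(\<lambda>i. ennreal ((X n x - X (r i) x)\<^sup>2)) \<longlonglongrightarrow> ennreal ((X n x - Y x)\<^sup>2)"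
          by (intro tendsto_ennrealI tendsto_intros)
        from lim_imp_Liminf[OF _ this] show ?case
          by simp
      qed
    qed
    also have "\<dots> \<le> liminf (\<lambda>i. \<integral>\<^sup>+x. ennreal ((X n x - X (r i) x)\<^sup>2) \<partial>M)"
      by (rule nn_integral_liminf) measurable
    also have "\<dots> \<le> liminf (\<lambda>i. ennreal e)"
    proof (rule Liminf_mono)
      show "\<forall>\<^sub>F i in sequentially. (\<integral>\<^sup>+x. ennreal ((X n x - X (r i) x)\<^sup>2) \<partial>M) \<le> ennreal e"
        using eventually_ge_at_top[of N]
      proof eventually_elim
        case (elim i)
        then have "r i \<ge> N"
          using seq_suble[OF r(1), of i] by simp
        then have "(\<integral>x. (X n x - X (r i) x)\<^sup>2 \<partial>M) \<le> e"
          using N[OF n] by (simp add: L2_norm_sq less_imp_le)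
        moreover have "(\<integral>\<^sup>+x. ennreal ((X n x - X (r i) x)\<^sup>2) \<partial>M)
            = ennreal (\<integral>x. (X n x - X (r i) x)\<^sup>2 \<partial>M)"
          by (intro nn_integral_eq_integral L2_integrable_sq L2_diff X) simp
        ultimately show ?case
          by (simp add: ennreal_leI)
      qed
    qed
    finally show ?thesis
      by (simp add: Liminf_const)
  qed
  have diff: "(\<lambda>x. X n x - Y x) \<in> L2 M" if "(\<integral>\<^sup>+x. ennreal ((X n x - Y x)\<^sup>2) \<partial>M) \<le> ennreal e" for n e
  proof -
    have "integrable M (\<lambda>x. (X n x - Y x)\<^sup>2)"
      using le_less_trans[OF that ennreal_less_top] by (intro integrableI_nonneg) auto
    then show ?thesis
      by (auto simp: L2_def)
  qed
  obtain N0 where N0: "\<And>i j. i \<ge> N0 \<Longrightarrow> j \<ge> N0 \<Longrightarrow> (L2_norm M (\<lambda>x. X i x - X j x))\<^sup>2 < 1"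
    using cauchy[of 1] by auto
  have "(\<lambda>x. X N0 x - (X N0 x - Y x)) \<in> L2 M"
    by (rule L2_diff[OF X diff[OF close[of N0 1 N0]]]) (use N0 in auto)
  then have YL2: "Y \<in> L2 M"
    by simp
  have "(\<lambda>n. (L2_norm M (\<lambda>x. X n x - Y x))\<^sup>2) \<longlonglongrightarrow> 0"
  proof (rule LIMSEQ_I)
    fix e :: real assume e: "0 < e"
    then obtain N where N: "\<And>i j. i \<ge> N \<Longrightarrow> j \<ge> N \<Longrightarrow> (L2_norm M (\<lambda>x. X i x - X j x))\<^sup>2 < e / 2"
      using cauchy[of "e / 2"] by auto
    have "norm ((L2_norm M (\<lambda>x. X n x - Y x))\<^sup>2 - 0) < e" if "n \<ge> N" for n
    proof -
      have "ennreal (\<integral>x. (X n x - Y x)\<^sup>2 \<partial>M) = (\<integral>\<^sup>+x. ennreal ((X n x - Y x)\<^sup>2) \<partial>M)"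
        by (intro nn_integral_eq_integral[symmetric] L2_integrable_sq L2_diff X YL2) simp
      also have "\<dots> \<le> ennreal (e / 2)"
        by (rule close[OF N that])
      finally have "(\<integral>x. (X n x - Y x)\<^sup>2 \<partial>M) \<le> e / 2"
        using e by simp
      then show ?thesis
        using e by (simp add: L2_norm_sq[symmetric])
    qed
    then show "\<exists>N. \<forall>n\<ge>N. norm ((L2_norm M (\<lambda>x. X n x - Y x))\<^sup>2 - 0) < e"
      by blast
  qed
  with YL2 show ?thesis
    by (rule that)
qed

section \<open>Integration against a kernel\<close>

text \<open>
  Positive and negative part are treated separately: for them the identity is the one for nonnegative
  integrals. The inner integral is meaningful only almost everywhere, elsewhere it has the default
  value 0.
\<close>

lemma
  fixes g :: "'b \<Rightarrow> real"
  assumes N: "space N \<noteq> {}" and K[measurable]: "K \<in> N \<rightarrow>\<^sub>M subprob_algebra B"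
    and g: "integrable (N \<bind> K) g"
  shows AE_integrable_kernel: "AE x in N. integrable (K x) g"
    and integrable_integral_kernel: "integrable N (\<lambda>x. \<integral>y. g y \<partial>K x)"
    and integral_integral_kernel: "(\<integral>x. \<integral>y. g y \<partial>K x \<partial>N) = (\<integral>y. g y \<partial>(N \<bind> K))"
proof -
  have [measurable_cong]: "sets (N \<bind> K) = sets B"
    by (rule sets_bind[OF sets_kernel[OF K] N])
  have sets_K: "sets (K x) = sets B" if "x \<in> space N" for x
    by (rule sets_kernel[OF K that])
  have AE: "AE x in N. integrable (K x) h" if h: "integrable (N \<bind> K) h" for h :: "'b \<Rightarrow> real"
  proof -
    have [measurable]: "h \<in> borel_measurable B"
      using borel_measurable_integrable[OF h] by simp
    have "(\<integral>\<^sup>+x. \<integral>\<^sup>+y. ennreal (norm (h y)) \<partial>K x \<partial>N) = (\<integral>\<^sup>+y. ennreal (norm (h y)) \<partial>(N \<bind> K))"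
      by (rule nn_integral_bind[symmetric, OF _ K]) measurable
    also have "\<dots> < \<infinity>"
      using h by (simp add: integrable_iff_bounded)
    finally have "AE x in N. (\<integral>\<^sup>+y. ennreal (norm (h y)) \<partial>K x) \<noteq> \<infinity>"
      by (intro nn_integral_PInf_AE) auto
    with AE_space show ?thesis
    proof eventually_elim
      case (elim x)
      then show ?case
        using sets_K[OF elim(1)]
        by (auto simp: integrable_iff_bounded less_top[symmetric] cong: measurable_cong_sets)
    qed
  qed
  have nonneg: "has_bochner_integral N (\<lambda>x. \<integral>y. h y \<partial>K x) (\<integral>y. h y \<partial>(N \<bind> K))"
    if h: "integrable (N \<bind> K) h" and h0: "\<And>y. 0 \<le> h y" for h :: "'b \<Rightarrow> real"
  proof (rule has_bochner_integral_nn_integral)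
    have [measurable]: "h \<in> borel_measurable B"
      using borel_measurable_integrable[OF h] by simp
    show "(\<lambda>x. \<integral>y. h y \<partial>K x) \<in> borel_measurable N"
      by measurable
    have "(\<integral>\<^sup>+x. ennreal (\<integral>y. h y \<partial>K x) \<partial>N) = (\<integral>\<^sup>+x. \<integral>\<^sup>+y. ennreal (h y) \<partial>K x \<partial>N)"
      using AE[OF h] by (intro nn_integral_cong_AE) (auto elim!: eventually_mono simp: nn_integral_eq_integral h0)
    also have "\<dots> = (\<integral>\<^sup>+y. ennreal (h y) \<partial>(N \<bind> K))"
      by (rule nn_integral_bind[symmetric, OF _ K]) measurable
    also have "\<dots> = ennreal (\<integral>y. h y \<partial>(N \<bind> K))"
      by (intro nn_integral_eq_integral h) (simp add: h0)
    finally show "(\<integral>\<^sup>+x. ennreal (\<integral>y. h y \<partial>K x) \<partial>N) = ennreal (\<integral>y. h y \<partial>(N \<bind> K))" .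
  qed (auto intro!: integral_nonneg_AE simp: h0)
  have [measurable]: "g \<in> borel_measurable B"
    using borel_measurable_integrable[OF g] by simp
  define p q where "p y = max (g y) 0" and "q y = max (- g y) 0" for y
  have pq: "integrable (N \<bind> K) p" "integrable (N \<bind> K) q"
    unfolding p_def[abs_def] q_def[abs_def] using g by auto
  have g_eq: "g = (\<lambda>y. p y - q y)"
    by (auto simp: p_def q_def)
  show "AE x in N. integrable (K x) g"
    by (rule AE[OF g])
  have "has_bochner_integral N (\<lambda>x. (\<integral>y. p y \<partial>K x) - (\<integral>y. q y \<partial>K x))
      ((\<integral>y. p y \<partial>(N \<bind> K)) - (\<integral>y. q y \<partial>(N \<bind> K)))"
    by (intro has_bochner_integral_diff nonneg pq) (auto simp: p_def q_def)
  moreover have "AE x in N. (\<integral>y. p y \<partial>K x) - (\<integral>y. q y \<partial>K x) = (\<integral>y. g y \<partial>K x)"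
    using AE[OF pq(1)] AE[OF pq(2)] by eventually_elim (simp add: g_eq)
  moreover have "(\<integral>y. p y \<partial>(N \<bind> K)) - (\<integral>y. q y \<partial>(N \<bind> K)) = (\<integral>y. g y \<partial>(N \<bind> K))"
    using pq by (simp add: g_eq)
  moreover have "(\<lambda>x. \<integral>y. p y \<partial>K x) \<in> borel_measurable N" "(\<lambda>x. \<integral>y. q y \<partial>K x) \<in> borel_measurable N"
    "(\<lambda>x. \<integral>y. g y \<partial>K x) \<in> borel_measurable N"
    unfolding p_def[abs_def] q_def[abs_def] by measurable
  ultimately have "has_bochner_integral N (\<lambda>x. \<integral>y. g y \<partial>K x) (\<integral>y. g y \<partial>(N \<bind> K))"
    by (subst has_bochner_integral_cong_AE[symmetric,
          of "\<lambda>x. (\<integral>y. p y \<partial>K x) - (\<integral>y. q y \<partial>K x)"]) auto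
  then show "integrable N (\<lambda>x. \<integral>y. g y \<partial>K x)" "(\<integral>x. \<integral>y. g y \<partial>K x \<partial>N) = (\<integral>y. g y \<partial>(N \<bind> K))"
    by (auto simp: has_bochner_integral_iff)
qed

section \<open>The Markov operator as a contraction\<close>

context stationary_markov_chain
begin

sublocale m: prob_space m
  by (rule prob_m)

sublocale Pm: prob_space Pm
  by (rule prob_Pm)

lemma kernel_subprob [measurable]: "K \<in> m \<rightarrow>\<^sub>M subprob_algebra m"
  by (rule measurable_prob_algebraD[OF kernel])

lemma prob_space_kernel: "x \<in> space m \<Longrightarrow> prob_space (K x)"
  using measurable_space[OF kernel] by (simp add: space_prob_algebra)

lemma sets_kernel_eq: "x \<in> space m \<Longrightarrow> sets (K x) = sets m"
  by (rule sets_kernel[OF kernel_subprob])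

text \<open>
  By invariance an \<open>m\<close>-null set is null for \<open>K x\<close>, for \<open>m\<close>-almost every \<open>x\<close>. This makes the Markov
  operator well defined on classes of functions that agree almost everywhere.
\<close>

lemma AE_kernel:
  assumes "AE x in m. Q x"
  shows "AE x in m. AE y in K x. Q y"
proof -
  obtain A where A: "A \<in> sets m" "{x \<in> space m. \<not> Q x} \<subseteq> A" "emeasure m A = 0"
    using assms by (auto elim: AE_E)
  have "AE x in m \<bind> K. x \<notin> A"
    unfolding invariant by (rule AE_not_in) (use A in auto)
  moreover have "Measurable.pred m (\<lambda>x. x \<notin> A)"
    using A(1) by measurable
  ultimately have "AE x in m. AE y in K x. y \<notin> A"
    using AE_bind[OF kernel_subprob] by blast
  with AE_space show ?thesis
  proof eventually_elim
    case (elim x)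
    have "space (K x) = space m"
      using sets_kernel_eq[OF elim(1)] by (rule sets_eq_imp_space_eq)
    from elim(2) AE_space show ?case
      by eventually_elim (use A(2) \<open>space (K x) = space m\<close> in auto)
  qed
qed

lemma AE_integrable_K: "integrable m g \<Longrightarrow> AE x in m. integrable (K x) (g :: 'a \<Rightarrow> real)"
  using AE_integrable_kernel[OF m.not_empty kernel_subprob] by (simp add: invariant)

lemma integrable_markov_operator: "integrable m g \<Longrightarrow> integrable m (markov_operator K g)"
  using integrable_integral_kernel[OF m.not_empty kernel_subprob]
  by (simp add: invariant markov_operator_def[abs_def])

lemma integral_markov_operator:
  "integrable m g \<Longrightarrow> (\<integral>x. markov_operator K g x \<partial>m) = (\<integral>x. g x \<partial>m)"
  using integral_integral_kernel[OF m.not_empty kernel_subprob]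
  by (simp add: invariant markov_operator_def[abs_def])

text \<open>
  Jensen's inequality for the kernel: the variance under \<open>K x\<close> is nonnegative.
\<close>

lemma markov_operator_sq_le:
  assumes g: "g \<in> L2 m"
  shows "AE x in m. (markov_operator K g x)\<^sup>2 \<le> markov_operator K (\<lambda>y. (g y)\<^sup>2) x"
  using AE_space AE_integrable_K[OF m.L2_integrable[OF g]] AE_integrable_K[OF L2_integrable_sq[OF g]]
proof eventually_elim
  case (elim x)
  interpret Kx: prob_space "K x"
    by (rule prob_space_kernel[OF elim(1)])
  have "Kx.variance g = Kx.expectation (\<lambda>y. (g y)\<^sup>2) - (Kx.expectation g)\<^sup>2"
    by (rule Kx.variance_eq[OF elim(2,3)])
  then show ?case
    using Kx.variance_positive[of g] by (simp add: markov_operator_def)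
qed

lemma markov_operator_L2:
  assumes g: "g \<in> L2 m"
  shows "markov_operator K g \<in> L2 m"
proof -
  have meas: "markov_operator K g \<in> borel_measurable m"
    by (rule borel_measurable_integrable[OF integrable_markov_operator[OF m.L2_integrable[OF g]]])
  have "integrable m (\<lambda>x. (markov_operator K g x)\<^sup>2)"
  proof (rule Bochner_Integration.integrable_bound)
    show "integrable m (markov_operator K (\<lambda>y. (g y)\<^sup>2))"
      by (rule integrable_markov_operator[OF L2_integrable_sq[OF g]])
    show "AE x in m. norm ((markov_operator K g x)\<^sup>2) \<le> norm (markov_operator K (\<lambda>y. (g y)\<^sup>2) x)"
      using markov_operator_sq_le[OF g] by eventually_elim auto
  qed (use meas in measurable)
  then show ?thesis
    using meas by (auto simp: L2_def)
qed

lemma markov_operator_contraction: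
  assumes g: "g \<in> L2 m"
  shows "L2_norm m (markov_operator K g) \<le> L2_norm m g"
proof -
  have "(\<integral>x. (markov_operator K g x)\<^sup>2 \<partial>m) \<le> (\<integral>x. markov_operator K (\<lambda>y. (g y)\<^sup>2) x \<partial>m)"
    by (intro integral_mono_AE markov_operator_sq_le L2_integrable_sq markov_operator_L2
        integrable_markov_operator g)
  then show ?thesis
    using integral_markov_operator[OF L2_integrable_sq[OF g]] by (simp add: L2_norm_def)
qed

lemma normal_L2_contraction_markov_operator:
  assumes "L2_normal m (markov_operator K)"
  shows "normal_L2_contraction m (markov_operator K)"
proof
  fix f g :: "'a \<Rightarrow> real" and c :: real
  assume f: "f \<in> L2 m"
  show "markov_operator K f \<in> L2 m" "L2_norm m (markov_operator K f) \<le> L2_norm m f"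
    by (rule markov_operator_L2[OF f] markov_operator_contraction[OF f])+
  show "AE x in m. markov_operator K (\<lambda>x. c * f x) x = c * markov_operator K f x"
    by (simp add: markov_operator_def)
  assume g: "g \<in> L2 m"
  show "AE x in m. markov_operator K (\<lambda>x. f x + g x) x = markov_operator K f x + markov_operator K g x"
    using AE_integrable_K[OF m.L2_integrable[OF f]] AE_integrable_K[OF m.L2_integrable[OF g]]
    by eventually_elim (simp add: markov_operator_def)
  assume eq: "AE x in m. f x = g x"
  show "AE x in m. markov_operator K f x = markov_operator K g x"
    using AE_space AE_kernel[OF eq]
  proof eventually_elim
    case (elim x)
    show ?case
      unfolding markov_operator_def using elim(2) L2_measurable[OF f] L2_measurable[OF g] sets_kernel_eq[OF elim(1)]
      by (intro integral_cong_AE) (auto cong: measurable_cong_sets)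
  qed
qed (rule assms)

end

section \<open>Orthogonality of martingale differences\<close>

text \<open>
  Pythagoras for martingale differences: \<open>Y\<^sub>n\<^sub>+\<^sub>1\<close> is orthogonal to everything square-integrable that is
  determined by \<open>F\<^sub>n\<close>, in particular to the earlier differences.
\<close>

lemma (in prob_space) sum_orthogonal_sq:
  fixes Y :: "nat \<Rightarrow> 'a \<Rightarrow> real"
  assumes sub: "\<And>k. subalgebra M (F k)" and mono: "\<And>i j. i \<le> j \<Longrightarrow> sets (F i) \<subseteq> sets (F j)"
    and L2: "\<And>k. Y k \<in> L2 M" and adapted: "\<And>k. Y k \<in> borel_measurable (F k)"
    and centred: "\<And>k A. A \<in> sets (F k) \<Longrightarrow> (\<integral>x\<in>A. Y (Suc k) x \<partial>M) = 0"
  shows "(L2_norm M (\<lambda>x. \<Sum>k=1..n. Y k x))\<^sup>2 = (\<Sum>k=1..n. (L2_norm M (Y k))\<^sup>2)"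
proof (induction n)
  case 0
  show ?case by (simp add: L2_norm_def)
next
  case (Suc n)
  interpret finite_measure_subalgebra M "F n"
    by unfold_locales (rule sub)
  have zero: "AE x in M. real_cond_exp M (F n) (Y (Suc n)) x = 0"
    by (rule real_cond_exp_charact) (auto simp: centred L2_integrable[OF L2])
  define S where "S x = (\<Sum>k=1..n. Y k x)" for x
  have S: "S \<in> L2 M"
    unfolding S_def[abs_def] by (intro L2_sum L2)
  have "Y k \<in> borel_measurable (F n)" if "k \<in> {1..n}" for k
  proof (rule measurable_from_subalg[OF _ adapted])
    have "space (F k) = space (F n)"
      using sub[of k] sub[of n] by (simp add: subalgebra_def)
    then show "subalgebra (F n) (F k)"
      using mono that by (auto simp: subalgebra_def)
  qed
  then have S_meas: "S \<in> borel_measurable (F n)"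
    unfolding S_def[abs_def] by (intro borel_measurable_sum) auto
  have Y_meas: "Y (Suc n) \<in> borel_measurable M"
    by (rule L2_measurable[OF L2])
  have "(\<integral>x. S x * Y (Suc n) x \<partial>M) = (\<integral>x. S x * real_cond_exp M (F n) (Y (Suc n)) x \<partial>M)"
    by (rule real_cond_exp_intg(2)[symmetric, OF L2_mult_integrable[OF S L2] S_meas Y_meas])
  also have "\<dots> = (\<integral>x. 0 \<partial>M)"
    using zero L2_measurable[OF S] by (intro integral_cong_AE) auto
  finally have cross: "(\<integral>x. S x * Y (Suc n) x \<partial>M) = 0"
    by simp
  have "(\<lambda>x. (\<Sum>k=1..Suc n. Y k x)\<^sup>2) = (\<lambda>x. (S x)\<^sup>2 + (Y (Suc n) x)\<^sup>2 + 2 * (S x * Y (Suc n) x))"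
    by (simp add: S_def power2_sum mult.assoc)
  then have "(L2_norm M (\<lambda>x. \<Sum>k=1..Suc n. Y k x))\<^sup>2 = (L2_norm M S)\<^sup>2 + (L2_norm M (Y (Suc n)))\<^sup>2"
    using cross S L2 by (simp only: L2_norm_sq) (simp add: L2_integrable_sq L2_mult_integrable)
  then show ?case
    using Suc.IH by (simp add: S_def[abs_def])
qed

section \<open>The two-sided chain\<close>

context stationary_markov_chain
begin

abbreviation past :: "int \<Rightarrow> (int \<Rightarrow> 'a) measure" where
  "past n \<equiv> natural_filtration m n"

lemma space_Pm: "space Pm = space (PiM UNIV (\<lambda>_. m))"
  by (rule sets_eq_imp_space_eq[OF sets_Pm])

lemma space_past: "space (past n) = space Pm"
  by (simp add: natural_filtration_def space_measure_of_conv space_Pm)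

lemma measurable_coord_Pm [measurable]: "(\<lambda>\<omega>. \<omega> k) \<in> Pm \<rightarrow>\<^sub>M m"
proof -
  have "(\<lambda>\<omega>. \<omega> k) \<in> PiM UNIV (\<lambda>_. m) \<rightarrow>\<^sub>M m"
    by (rule measurable_component_singleton) simp
  then show ?thesis
    by (simp add: measurable_cong_sets[OF sets_Pm refl])
qed

lemma sets_past:
  "sets (past n) = sigma_sets (space Pm) {(\<lambda>\<omega>. \<omega> k) -` A \<inter> space Pm | k A. k \<le> n \<and> A \<in> sets m}"
  unfolding natural_filtration_def space_Pm by (rule sets_measure_of) auto

lemma coord_in_past: "k \<le> n \<Longrightarrow> A \<in> sets m \<Longrightarrow> (\<lambda>\<omega>. \<omega> k) -` A \<inter> space Pm \<in> sets (past n)"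
  unfolding sets_past by (rule sigma_sets.Basic) auto

lemma past_mono: "i \<le> j \<Longrightarrow> sets (past i) \<subseteq> sets (past j)"
  unfolding sets_past by (rule sigma_sets_mono') (auto intro: order_trans)

lemma past_subset: "sets (past n) \<subseteq> sets Pm"
  unfolding sets_past
proof (rule sets.sigma_sets_subset)
  show "{(\<lambda>\<omega>. \<omega> k) -` A \<inter> space Pm | k A. k \<le> n \<and> A \<in> sets m} \<subseteq> sets Pm"
    using measurable_sets[OF measurable_coord_Pm] by auto
qed

lemma subalgebra_past: "subalgebra Pm (past n)"
  by (simp add: subalgebra_def space_past past_subset)

lemma measurable_coord_past: "k \<le> n \<Longrightarrow> (\<lambda>\<omega>. \<omega> k) \<in> past n \<rightarrow>\<^sub>M m"
  by (rule measurableI) (auto simp: space_past coord_in_past intro: measurable_space[OF measurable_coord_Pm])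

lemma measurable_past_mono:
  assumes "i \<le> j" "X \<in> borel_measurable (past i)"
  shows "X \<in> borel_measurable (past j)"
  by (rule measurable_from_subalg[OF _ assms(2)]) (simp add: subalgebra_def space_past past_mono assms(1))

lemma finite_measure_subalgebra_past: "finite_measure_subalgebra Pm (past n)"
  by unfold_locales (rule subalgebra_past)

lemma path_shift_space: "\<omega> \<in> space Pm \<Longrightarrow> path_shift \<omega> \<in> space Pm"
  by (simp add: space_Pm space_PiM path_shift_def PiE_iff)

lemma measurable_path_shift: "path_shift \<in> Pm \<rightarrow>\<^sub>M Pm"
proof -
  have "path_shift \<in> Pm \<rightarrow>\<^sub>M PiM UNIV (\<lambda>_. m)"
  proof (rule measurable_PiM_single')
    show "(\<lambda>\<omega>. path_shift \<omega> k) \<in> Pm \<rightarrow>\<^sub>M m" for k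
      by (simp add: path_shift_def)
    show "path_shift \<in> space Pm \<rightarrow> (\<Pi>\<^sub>E i\<in>UNIV. space m)"
      using path_shift_space by (simp add: space_Pm space_PiM)
  qed
  then show ?thesis
    by (simp add: measurable_cong_sets[OF refl sets_Pm])
qed

lemma measurable_path_shift_past: "path_shift \<in> past (n + 1) \<rightarrow>\<^sub>M past n"
proof -
  have "path_shift \<in> past (n + 1) \<rightarrow>\<^sub>M
      sigma (space Pm) {(\<lambda>\<omega>. \<omega> k) -` A \<inter> space Pm | k A. k \<le> n \<and> A \<in> sets m}"
  proof (rule measurable_measure_of)
    fix B assume "B \<in> {(\<lambda>\<omega>. \<omega> k) -` A \<inter> space Pm | k A. k \<le> n \<and> A \<in> sets m}"
    then obtain k A where B: "B = (\<lambda>\<omega>. \<omega> k) -` A \<inter> space Pm" "k \<le> n" "A \<in> sets m"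
      by auto
    have "path_shift -` B \<inter> space (past (n + 1)) = (\<lambda>\<omega>. \<omega> (k + 1)) -` A \<inter> space Pm"
      using path_shift_space by (auto simp: B(1) space_past path_shift_def)
    then show "path_shift -` B \<inter> space (past (n + 1)) \<in> sets (past (n + 1))"
      using coord_in_past[of "k + 1" "n + 1" A] B by simp
  qed (auto simp: space_past path_shift_space)
  then show ?thesis
    by (simp add: natural_filtration_def space_Pm)
qed

lemma funpow_path_shift: "(path_shift ^^ k) \<omega> = (\<lambda>i. \<omega> (i + int k))"
  by (induction k) (auto simp: path_shift_def algebra_simps)

lemma measurable_funpow_path_shift: "path_shift ^^ k \<in> Pm \<rightarrow>\<^sub>M Pm"
  by (rule measurable_compose_n[OF measurable_path_shift])

text \<open>
  Shifting by \<open>k\<close> turns knowledge of the path up to time \<open>n\<close> into knowledge up to time \<open>n + k\<close>; this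
  makes the summands \<open>M \<circ> \<theta>\<^sup>k\<close> adapted.
\<close>

lemma measurable_funpow_path_shift_past: "path_shift ^^ k \<in> past (n + int k) \<rightarrow>\<^sub>M past n"
proof (induction k)
  case 0
  show ?case
    by simp
next
  case (Suc k)
  have "path_shift ^^ k \<circ> path_shift \<in> past (n + int k + 1) \<rightarrow>\<^sub>M past n"
    by (rule measurable_comp[OF measurable_path_shift_past Suc.IH])
  then show ?case
    by (simp only: funpow_Suc_right of_nat_Suc add.assoc add.commute[of 1])
qed

lemma distr_funpow_path_shift: "distr Pm Pm (path_shift ^^ k) = Pm"
proof (induction k)
  case (Suc k)
  have "distr Pm Pm (path_shift ^^ Suc k) = distr (distr Pm Pm path_shift) Pm (path_shift ^^ k)"
    by (simp only: funpow_Suc_right distr_distr[OF measurable_funpow_path_shift measurable_path_shift])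
  then show ?case
    by (simp only: stationary Suc.IH)
qed (simp add: distr_id id_def)

lemma L2_shift:
  assumes "X \<in> L2 Pm"
  shows "(\<lambda>\<omega>. X ((path_shift ^^ k) \<omega>)) \<in> L2 Pm"
    and "L2_norm Pm (\<lambda>\<omega>. X ((path_shift ^^ k) \<omega>)) = L2_norm Pm X"
proof -
  have X: "X \<in> borel_measurable Pm" "(\<lambda>\<omega>. (X \<omega>)\<^sup>2) \<in> borel_measurable Pm"
    using L2_measurable[OF assms] by auto
  have "integrable (distr Pm Pm (path_shift ^^ k)) (\<lambda>\<omega>. (X \<omega>)\<^sup>2)"
    by (simp add: distr_funpow_path_shift L2_integrable_sq[OF assms])
  then show "(\<lambda>\<omega>. X ((path_shift ^^ k) \<omega>)) \<in> L2 Pm"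
    using integrable_distr[OF measurable_funpow_path_shift]
      measurable_compose[OF measurable_funpow_path_shift X(1)] by (auto simp: L2_def)
  show "L2_norm Pm (\<lambda>\<omega>. X ((path_shift ^^ k) \<omega>)) = L2_norm Pm X"
    using integral_distr[OF measurable_funpow_path_shift[of k] X(2)]
    by (simp add: L2_norm_def distr_funpow_path_shift)
qed

text \<open>
  Stationarity makes the law of \<open>W\<^sub>k\<close> independent of \<open>k\<close>, also backwards in time.
\<close>

lemma distr_coord: "distr Pm m (\<lambda>\<omega>. \<omega> k) = m"
proof -
  have step: "distr Pm m (\<lambda>\<omega>. \<omega> (k + 1)) = distr Pm m (\<lambda>\<omega>. \<omega> k)" for k
  proof -
    have "distr Pm m (\<lambda>\<omega>. \<omega> k) = distr (distr Pm Pm path_shift) m (\<lambda>\<omega>. \<omega> k)"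
      by (simp only: stationary)
    also have "\<dots> = distr Pm m (\<lambda>\<omega>. \<omega> (k + 1))"
      by (subst distr_distr[OF measurable_coord_Pm measurable_path_shift]) (simp add: comp_def path_shift_def)
    finally show ?thesis ..
  qed
  show ?thesis
  proof (induction k rule: int_induct[where k = 0])
    case base
    show ?case by (rule initial)
  next
    case (step1 i)
    then show ?case using step[of i] by simp
  next
    case (step2 i)
    then show ?case using step[of "i - 1"] by simp
  qed
qed

lemma L2_coord:
  assumes "g \<in> L2 m"
  shows "(\<lambda>\<omega>. g (\<omega> k)) \<in> L2 Pm" and "L2_norm Pm (\<lambda>\<omega>. g (\<omega> k)) = L2_norm m g"
proof -
  have g: "g \<in> borel_measurable m" "(\<lambda>x. (g x)\<^sup>2) \<in> borel_measurable m"
    using L2_measurable[OF assms] by auto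
  have "integrable (distr Pm m (\<lambda>\<omega>. \<omega> k)) (\<lambda>x. (g x)\<^sup>2)"
    by (simp add: distr_coord L2_integrable_sq[OF assms])
  then show "(\<lambda>\<omega>. g (\<omega> k)) \<in> L2 Pm"
    using integrable_distr[OF measurable_coord_Pm] measurable_compose[OF measurable_coord_Pm g(1)]
    by (auto simp: L2_def)
  show "L2_norm Pm (\<lambda>\<omega>. g (\<omega> k)) = L2_norm m g"
    using integral_distr[OF measurable_coord_Pm[of k] g(2)] by (simp add: L2_norm_def distr_coord)
qed

lemma AE_coord:
  assumes "AE x in m. Q x"
  shows "AE \<omega> in Pm. Q (\<omega> k)"
proof -
  have "AE x in distr Pm m (\<lambda>\<omega>. \<omega> k). Q x"
    using assms by (simp only: distr_coord)
  then show ?thesis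
    by (rule AE_distrD[OF measurable_coord_Pm])
qed

lemma markov_set_integral_indicator:
  assumes A: "A \<in> sets (past n)" and B: "B \<in> sets m"
  shows "(\<integral>\<omega>\<in>A. indicator B (\<omega> (n + 1)) \<partial>Pm) = (\<integral>\<omega>\<in>A. measure (K (\<omega> n)) B \<partial>Pm)"
proof -
  interpret finite_measure_subalgebra Pm "past n"
    by (rule finite_measure_subalgebra_past)
  have [measurable]: "A \<in> sets Pm" "B \<in> sets m"
    using A B past_subset by auto
  have "integrable Pm (\<lambda>\<omega>. indicator B (\<omega> (n + 1)) :: real)"
    by (rule Pm.integrable_const_bound[where B = 1]) (auto simp: indicator_def)
  then have "(\<integral>\<omega>\<in>A. indicator B (\<omega> (n + 1)) \<partial>Pm)
      = (\<integral>\<omega>\<in>A. real_cond_exp Pm (past n) (\<lambda>\<omega>. indicator B (\<omega> (n + 1))) \<omega> \<partial>Pm)"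
    by (rule real_cond_exp_intA[OF _ A])
  also have "\<dots> = (\<integral>\<omega>\<in>A. measure (K (\<omega> n)) B \<partial>Pm)"
    using markov[OF B, of n] unfolding set_lebesgue_integral_def
    by (intro integral_cong_AE) (auto elim!: eventually_mono)
  finally show ?thesis .
qed

text \<open>
  The Markov property extends from indicators to integrable functions because it says that, on any
  event of the past, the law of the next state is the law of the present state composed with the
  kernel.
\<close>

lemma markov_set_integral:
  assumes A: "A \<in> sets (past n)" and g: "integrable m g"
  shows "(\<integral>\<omega>\<in>A. g (\<omega> (n + 1)) \<partial>Pm) = (\<integral>\<omega>\<in>A. markov_operator K g (\<omega> n) \<partial>Pm)"
proof -
  have AP[measurable]: "A \<in> sets Pm"
    using A past_subset by auto
  have gm[measurable]: "g \<in> borel_measurable m"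
    by (rule borel_measurable_integrable[OF g])
  \<comment> \<open>\<open>N\<close> and \<open>N'\<close> are the laws of the states at times \<open>n\<close> and \<open>n + 1\<close> on the event \<open>A\<close>.\<close>
  let ?D = "density Pm (\<lambda>\<omega>. ennreal (indicator A \<omega>))"
  define N where "N = distr ?D m (\<lambda>\<omega>. \<omega> n)"
  define N' where "N' = distr ?D m (\<lambda>\<omega>. \<omega> (n + 1))"
  have N: "space N \<noteq> {}" and [measurable_cong]: "sets N = sets m"
    using m.not_empty by (simp_all add: N_def)
  have KN: "K \<in> N \<rightarrow>\<^sub>M subprob_algebra m"
    using kernel_subprob by (simp add: N_def)
  have "N \<bind> K = N'"
  proof (rule measure_eqI)
    show sets_eq: "sets (N \<bind> K) = sets N'"
      using sets_bind[OF sets_kernel[OF KN] N] by (simp add: N'_def)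
    fix B assume "B \<in> sets (N \<bind> K)"
    then have B[measurable]: "B \<in> sets m"
      using sets_eq by (simp add: N'_def)
    have mK: "(\<lambda>x. emeasure (K x) B) \<in> borel_measurable m"
      by measurable
    have "emeasure (N \<bind> K) B = (\<integral>\<^sup>+x. emeasure (K x) B \<partial>N)"
      by (rule emeasure_bind[OF N KN B])
    also have "\<dots> = (\<integral>\<^sup>+\<omega>. emeasure (K (\<omega> n)) B \<partial>?D)"
      unfolding N_def by (subst nn_integral_distr) auto
    also have "\<dots> = (\<integral>\<^sup>+\<omega>. ennreal (indicator A \<omega>) * emeasure (K (\<omega> n)) B \<partial>Pm)"
      by (subst nn_integral_density) auto
    also have "\<dots> = (\<integral>\<^sup>+\<omega>. ennreal (indicator A \<omega> * measure (K (\<omega> n)) B) \<partial>Pm)"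
    proof (rule nn_integral_cong)
      fix \<omega> assume "\<omega> \<in> space Pm"
      then have "prob_space (K (\<omega> n))"
        by (intro prob_space_kernel measurable_space[OF measurable_coord_Pm])
      then have "emeasure (K (\<omega> n)) B = ennreal (measure (K (\<omega> n)) B)"
        by (rule finite_measure.emeasure_eq_measure[OF prob_space.finite_measure])
      then show "ennreal (indicator A \<omega>) * emeasure (K (\<omega> n)) B
          = ennreal (indicator A \<omega> * measure (K (\<omega> n)) B)"
        by (simp add: ennreal_mult)
    qed
    also have "\<dots> = ennreal (\<integral>\<omega>\<in>A. measure (K (\<omega> n)) B \<partial>Pm)"
    proof -
      have "AE \<omega> in Pm. measure (K (\<omega> n)) B \<le> 1"
      proof (rule AE_I2)
        fix \<omega> assume "\<omega> \<in> space Pm"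
        then have "prob_space (K (\<omega> n))"
          by (intro prob_space_kernel measurable_space[OF measurable_coord_Pm])
        then show "measure (K (\<omega> n)) B \<le> 1"
          by (rule prob_space.prob_le_1)
      qed
      then have "integrable Pm (\<lambda>\<omega>. indicator A \<omega> * measure (K (\<omega> n)) B)"
        by (intro Pm.integrable_const_bound[where B = 1])
          (auto elim!: eventually_mono simp: indicator_def)
      then show ?thesis
        by (subst nn_integral_eq_integral) (auto simp: set_lebesgue_integral_def)
    qed
    also have "(\<integral>\<omega>\<in>A. measure (K (\<omega> n)) B \<partial>Pm) = (\<integral>\<omega>\<in>A. indicator B (\<omega> (n + 1)) \<partial>Pm)"
      by (rule markov_set_integral_indicator[OF A B, symmetric])
    also have "ennreal \<dots> = (\<integral>\<^sup>+\<omega>. ennreal (indicator A \<omega> * indicator B (\<omega> (n + 1))) \<partial>Pm)"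
    proof -
      have "integrable Pm (\<lambda>\<omega>. indicator A \<omega> * indicator B (\<omega> (n + 1)) :: real)"
        by (rule Pm.integrable_const_bound[where B = 1]) (auto simp: indicator_def)
      then show ?thesis
        by (subst nn_integral_eq_integral) (auto simp: set_lebesgue_integral_def)
    qed
    also have "\<dots> = (\<integral>\<^sup>+\<omega>. ennreal (indicator A \<omega>) * indicator B (\<omega> (n + 1)) \<partial>Pm)"
      by (intro nn_integral_cong) (auto simp: indicator_def)
    also have "\<dots> = (\<integral>\<^sup>+\<omega>. indicator B (\<omega> (n + 1)) \<partial>?D)"
      by (subst nn_integral_density) auto
    also have "\<dots> = (\<integral>\<^sup>+x. indicator B x \<partial>N')"
      unfolding N'_def by (subst nn_integral_distr) auto
    also have "\<dots> = emeasure N' B"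
      using B by (simp add: N'_def)
    finally show "emeasure (N \<bind> K) B = emeasure N' B" .
  qed
  note bind_eq = this
  have gP: "integrable Pm (\<lambda>\<omega>. g (\<omega> (n + 1)))"
  proof -
    have "integrable (distr Pm m (\<lambda>\<omega>. \<omega> (n + 1))) g"
      using g by (simp only: distr_coord)
    then show ?thesis
      by (subst (asm) integrable_distr_eq) auto
  qed
  have "integrable N' g"
    unfolding N'_def
    by (subst integrable_distr_eq, simp, simp, subst integrable_density)
      (use integrable_mult_indicator[OF AP gP] in auto)
  then have "(\<integral>x. (\<integral>y. g y \<partial>K x) \<partial>N) = (\<integral>y. g y \<partial>N')"
    using integral_integral_kernel[OF N KN, of g] by (simp add: bind_eq)
  moreover have "(\<integral>y. g y \<partial>N') = (\<integral>\<omega>\<in>A. g (\<omega> (n + 1)) \<partial>Pm)"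
    unfolding N'_def
    by (subst integral_distr, simp, simp, subst integral_density) (auto simp: set_lebesgue_integral_def)
  moreover have "(\<integral>x. (\<integral>y. g y \<partial>K x) \<partial>N) = (\<integral>\<omega>\<in>A. markov_operator K g (\<omega> n) \<partial>Pm)"
    unfolding N_def markov_operator_def
    by (subst integral_distr, simp, simp, subst integral_density) (auto simp: set_lebesgue_integral_def)
  ultimately show ?thesis
    by simp
qed

end

section \<open>Martingale differences of the chain\<close>

context stationary_markov_chain
begin

text \<open>
  The martingale difference \<open>g(W\<^sub>k) - E[g(W\<^sub>k) | F\<^sub>k\<^sub>-\<^sub>1]\<close>.
\<close>

definition increment :: "('a \<Rightarrow> real) \<Rightarrow> int \<Rightarrow> (int \<Rightarrow> 'a) \<Rightarrow> real" where
  "increment g k \<omega> = g (\<omega> k) - markov_operator K g (\<omega> (k - 1))"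

lemma increment_L2: "g \<in> L2 m \<Longrightarrow> increment g k \<in> L2 Pm"
  unfolding increment_def[abs_def] by (intro L2_diff L2_coord markov_operator_L2)

lemma increment_adapted:
  assumes "g \<in> L2 m"
  shows "increment g k \<in> borel_measurable (past k)"
proof -
  have "(\<lambda>\<omega>. g (\<omega> k)) \<in> borel_measurable (past k)"
    by (rule measurable_compose[OF measurable_coord_past L2_measurable[OF assms]]) simp
  moreover have "(\<lambda>\<omega>. markov_operator K g (\<omega> (k - 1))) \<in> borel_measurable (past k)"
    by (rule measurable_compose[OF measurable_coord_past L2_measurable[OF markov_operator_L2[OF assms]]]) simp
  ultimately show ?thesis
    unfolding increment_def[abs_def] by (rule borel_measurable_diff)
qed

lemma increment_centred:
  assumes g: "g \<in> L2 m" and A: "A \<in> sets (past (k - 1))"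
  shows "(\<integral>\<omega>\<in>A. increment g k \<omega> \<partial>Pm) = 0"
proof -
  have AP: "A \<in> sets Pm"
    using A past_subset by auto
  have "set_integrable Pm A (\<lambda>\<omega>. g (\<omega> k))" "set_integrable Pm A (\<lambda>\<omega>. markov_operator K g (\<omega> (k - 1)))"
    unfolding set_integrable_def
    by (intro integrable_mult_indicator AP Pm.L2_integrable L2_coord markov_operator_L2 g)+
  then show ?thesis
    using markov_set_integral[OF A m.L2_integrable[OF g]]
    by (simp add: increment_def set_integral_diff)
qed

lemma increment_shift: "increment g j ((path_shift ^^ k) \<omega>) = increment g (j + int k) \<omega>"
  by (simp add: increment_def funpow_path_shift algebra_simps)

text \<open>
  \<open>(P g)(W\<^sub>k\<^sub>-\<^sub>1)\<close> is the orthogonal projection of \<open>g(W\<^sub>k)\<close> to the past. The squared norm of the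
  remainder is thus the defect \<open>\<parallel>g\<parallel>\<^sup>2 - \<parallel>P g\<parallel>\<^sup>2\<close>, which links the operator estimates to the chain.
\<close>

lemma increment_norm:
  assumes g: "g \<in> L2 m"
  shows "(L2_norm Pm (increment g k))\<^sup>2 = (L2_norm m g)\<^sup>2 - (L2_norm m (markov_operator K g))\<^sup>2"
proof -
  interpret finite_measure_subalgebra Pm "past (k - 1)"
    by (rule finite_measure_subalgebra_past)
  let ?Q = "markov_operator K g"
  have Q: "?Q \<in> L2 m"
    by (rule markov_operator_L2[OF g])
  define u v where "u \<omega> = g (\<omega> k)" and "v \<omega> = ?Q (\<omega> (k - 1))" for \<omega> :: "int \<Rightarrow> 'a"
  have uv: "u \<in> L2 Pm" "v \<in> L2 Pm"
    unfolding u_def[abs_def] v_def[abs_def] by (intro L2_coord g Q)+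
  have norms: "L2_norm Pm u = L2_norm m g" "L2_norm Pm v = L2_norm m ?Q"
    unfolding u_def[abs_def] v_def[abs_def] by (intro L2_coord g Q)+
  have v_past: "v \<in> borel_measurable (past (k - 1))"
    unfolding v_def[abs_def]
    by (rule measurable_compose[OF measurable_coord_past L2_measurable[OF Q]]) simp
  have cond: "AE \<omega> in Pm. real_cond_exp Pm (past (k - 1)) u \<omega> = v \<omega>"
  proof (rule real_cond_exp_charact)
    fix A assume "A \<in> sets (past (k - 1))"
    from markov_set_integral[OF this m.L2_integrable[OF g]]
    show "(\<integral>\<omega>\<in>A. u \<omega> \<partial>Pm) = (\<integral>\<omega>\<in>A. v \<omega> \<partial>Pm)"
      by (simp add: u_def v_def)
  qed (use uv v_past Pm.L2_integrable in auto)
  have "(\<integral>\<omega>. v \<omega> * u \<omega> \<partial>Pm) = (\<integral>\<omega>. v \<omega> * real_cond_exp Pm (past (k - 1)) u \<omega> \<partial>Pm)"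
    by (rule real_cond_exp_intg(2)[symmetric, OF L2_mult_integrable[OF uv(2,1)] v_past L2_measurable[OF uv(1)]])
  also have "\<dots> = (\<integral>\<omega>. v \<omega> * v \<omega> \<partial>Pm)"
    using cond L2_measurable[OF uv(2)] by (intro integral_cong_AE) auto
  finally have "L2_inner Pm u v = (L2_norm Pm v)\<^sup>2"
    by (simp add: L2_inner_self[symmetric]) (simp add: L2_inner_def mult.commute)
  moreover have "increment g k = (\<lambda>\<omega>. u \<omega> - v \<omega>)"
    by (simp add: increment_def u_def v_def fun_eq_iff)
  ultimately show ?thesis
    using L2_norm_diff_sq[OF uv] norms by simp
qed

text \<open>
  Completeness is applied over the past, so that the limit is measurable with respect to it and not
  merely almost everywhere equal to such a function.
\<close>

lemma martingale_difference_limit: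
  assumes X: "\<And>n. X n \<in> L2 Pm" and adapted: "\<And>n. X n \<in> borel_measurable (past 0)"
    and cauchy: "\<And>e. e > 0 \<Longrightarrow> \<exists>N. \<forall>i\<ge>N. \<forall>j\<ge>N. (L2_norm Pm (\<lambda>\<omega>. X i \<omega> - X j \<omega>))\<^sup>2 < e"
  obtains Y where "Y \<in> L2 Pm" "Y \<in> borel_measurable (past 0)"
    "(\<lambda>n. (L2_norm Pm (\<lambda>\<omega>. X n \<omega> - Y \<omega>))\<^sup>2) \<longlonglongrightarrow> 0"
proof -
  let ?R = "restr_to_subalg Pm (past 0)"
  interpret R: prob_space ?R
    by (rule prob_space_restr_to_subalg[OF subalgebra_past prob_Pm])
  have norm_eq: "L2_norm ?R Z = L2_norm Pm Z" if "Z \<in> borel_measurable (past 0)" for Z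
    unfolding L2_norm_def using that
    by (subst integral_subalgebra2[OF subalgebra_past]) auto
  have XR: "X n \<in> L2 ?R" for n
    using X[of n] adapted[of n] measurable_in_subalg[OF subalgebra_past adapted[of n]]
    by (auto simp: L2_def intro!: integrable_in_subalg[OF subalgebra_past])
  have "\<exists>N. \<forall>i\<ge>N. \<forall>j\<ge>N. (L2_norm ?R (\<lambda>\<omega>. X i \<omega> - X j \<omega>))\<^sup>2 < e" if "e > 0" for e
    using cauchy[OF that] adapted by (subst norm_eq) (auto intro: borel_measurable_diff)
  then obtain Y where Y: "Y \<in> L2 ?R" "(\<lambda>n. (L2_norm ?R (\<lambda>\<omega>. X n \<omega> - Y \<omega>))\<^sup>2) \<longlonglongrightarrow> 0"
    using R.L2_complete[of X, OF XR] by blast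
  have Ym: "Y \<in> borel_measurable (past 0)"
    using measurable_in_subalg'[OF subalgebra_past L2_measurable[OF Y(1)]] .
  have "Y \<in> L2 Pm"
    using Y(1) measurable_from_subalg[OF subalgebra_past Ym] integrable_from_subalg[OF subalgebra_past]
    by (auto simp: L2_def)
  moreover have "(\<lambda>n. (L2_norm Pm (\<lambda>\<omega>. X n \<omega> - Y \<omega>))\<^sup>2) \<longlonglongrightarrow> 0"
    using Y(2) adapted Ym by (subst (asm) norm_eq) (auto intro: borel_measurable_diff)
  ultimately show ?thesis
    using Ym that by blast
qed

text \<open>
  \<open>L\<^sup>2\<close>-convergence implies convergence of the integral over each event, because it implies
  \<open>L\<^sup>1\<close>-convergence on a probability space.
\<close>

lemma centred_limit:
  assumes X: "\<And>n. X n \<in> L2 Pm" and Y: "Y \<in> L2 Pm" and A: "A \<in> sets Pm"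
    and lim: "(\<lambda>n. (L2_norm Pm (\<lambda>\<omega>. X n \<omega> - Y \<omega>))\<^sup>2) \<longlonglongrightarrow> 0"
    and centred: "\<And>n. (\<integral>\<omega>\<in>A. X n \<omega> \<partial>Pm) = 0"
  shows "(\<integral>\<omega>\<in>A. Y \<omega> \<partial>Pm) = 0"
proof (rule ccontr)
  define e where "e = \<bar>\<integral>\<omega>\<in>A. Y \<omega> \<partial>Pm\<bar>"
  assume "(\<integral>\<omega>\<in>A. Y \<omega> \<partial>Pm) \<noteq> 0"
  then have e: "e > 0"
    by (simp add: e_def)
  have "\<forall>\<^sub>F n in sequentially. (L2_norm Pm (\<lambda>\<omega>. X n \<omega> - Y \<omega>))\<^sup>2 < e\<^sup>2"
    using order_tendstoD(2)[OF lim, of "e\<^sup>2"] e by simp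
  then obtain n where n: "(L2_norm Pm (\<lambda>\<omega>. X n \<omega> - Y \<omega>))\<^sup>2 < e\<^sup>2"
    by (auto simp: eventually_sequentially)
  have int: "integrable Pm (X n)" "integrable Pm Y" "integrable Pm (\<lambda>\<omega>. X n \<omega> - Y \<omega>)"
    by (intro Pm.L2_integrable X Y L2_diff)+
  have "set_integrable Pm A (X n)" "set_integrable Pm A Y"
    unfolding set_integrable_def by (intro integrable_mult_indicator A int)+
  from set_integral_diff(2)[OF this] have "(\<integral>\<omega>\<in>A. Y \<omega> \<partial>Pm) = - (\<integral>\<omega>\<in>A. X n \<omega> - Y \<omega> \<partial>Pm)"
    using centred[of n] by simp
  then have "e = \<bar>\<integral>\<omega>. indicator A \<omega> * (X n \<omega> - Y \<omega>) \<partial>Pm\<bar>"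
    by (simp add: e_def set_lebesgue_integral_def)
  also have "\<dots> \<le> (\<integral>\<omega>. \<bar>indicator A \<omega> * (X n \<omega> - Y \<omega>)\<bar> \<partial>Pm)"
    by (rule integral_abs_bound)
  also have "\<dots> \<le> (\<integral>\<omega>. \<bar>X n \<omega> - Y \<omega>\<bar> \<partial>Pm)"
    using int(3) integrable_mult_indicator[OF A int(3)]
    by (intro integral_mono) (auto simp: indicator_def)
  also have "\<dots> \<le> e / 2 + (L2_norm Pm (\<lambda>\<omega>. X n \<omega> - Y \<omega>))\<^sup>2 / (2 * e)"
    by (rule Pm.integral_abs_le_L2[OF L2_diff[OF X Y] e])
  also have "\<dots> < e / 2 + e\<^sup>2 / (2 * e)"
    using n e by (intro add_strict_left_mono divide_strict_right_mono) auto
  also have "\<dots> = e"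
    using e by (simp add: power2_eq_square)
  finally show False
    by simp
qed

lemma is_martingale_shift_sum:
  assumes Y: "Y \<in> L2 Pm" "Y \<in> borel_measurable (past 0)"
    and centred: "\<And>k A. A \<in> sets (past (int k)) \<Longrightarrow> (\<integral>\<omega>\<in>A. Y ((path_shift ^^ Suc k) \<omega>) \<partial>Pm) = 0"
  shows "is_martingale Pm (\<lambda>n. past (int n)) (shift_sum path_shift Y)"
proof -
  define Z where "Z k \<omega> = Y ((path_shift ^^ k) \<omega>)" for k \<omega>
  have Z: "Z k \<in> L2 Pm" for k
    unfolding Z_def[abs_def] by (rule L2_shift(1)[OF Y(1)])
  have Z_past: "Z k \<in> borel_measurable (past (int k))" for k
    unfolding Z_def[abs_def]
    using measurable_compose[OF measurable_funpow_path_shift_past[of k 0] Y(2)] by simp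
  have sum: "shift_sum path_shift Y n = (\<lambda>\<omega>. \<Sum>k=1..n. Z k \<omega>)" for n
    by (simp add: shift_sum_def Z_def fun_eq_iff)
  have meas: "shift_sum path_shift Y n \<in> borel_measurable (past (int n))" for n
    unfolding sum
    by (intro borel_measurable_sum measurable_past_mono[OF _ Z_past]) auto
  have L2: "shift_sum path_shift Y n \<in> L2 Pm" for n
    unfolding sum by (intro L2_sum Z)
  have "AE \<omega> in Pm. real_cond_exp Pm (past (int i)) (shift_sum path_shift Y j) \<omega> = shift_sum path_shift Y i \<omega>"
    if "i \<le> j" for i j
  proof -
    interpret finite_measure_subalgebra Pm "past (int i)"
      by (rule finite_measure_subalgebra_past)
    show ?thesis
    proof (rule real_cond_exp_charact[OF _ _ _ meas])
      fix A assume A: "A \<in> sets (past (int i))"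
      have AP: "A \<in> sets Pm"
        using A past_subset by auto
      show "(\<integral>\<omega>\<in>A. shift_sum path_shift Y j \<omega> \<partial>Pm) = (\<integral>\<omega>\<in>A. shift_sum path_shift Y i \<omega> \<partial>Pm)"
        using that
      proof (induction j rule: dec_induct)
        case (step j)
        have "A \<in> sets (past (int j))"
          using A past_mono[of "int i" "int j"] step.hyps by auto
        then have "(\<integral>\<omega>\<in>A. Z (Suc j) \<omega> \<partial>Pm) = 0"
          unfolding Z_def by (rule centred)
        moreover have "set_integrable Pm A (Z (Suc j))" "set_integrable Pm A (shift_sum path_shift Y j)"
          unfolding set_integrable_def by (intro integrable_mult_indicator AP Pm.L2_integrable L2 Z)+
        moreover have "shift_sum path_shift Y (Suc j) = (\<lambda>\<omega>. shift_sum path_shift Y j \<omega> + Z (Suc j) \<omega>)"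
          by (simp add: sum)
        ultimately show ?case
          using step.IH by (simp add: set_integral_add)
      qed simp
    qed (intro Pm.L2_integrable L2)+
  qed
  then show ?thesis
    using meas L2 Pm.L2_integrable by (simp add: is_martingale_def)
qed

end

section \<open>The martingale approximation\<close>

locale normal_stationary_chain = stationary_markov_chain + op: normal_L2_contraction m "markov_operator K"
begin

lemma orbit_sum_eq_U: "op.orbit_sum f n = U K f n"
  by (simp add: op.orbit_sum_def U_def fun_eq_iff)

lemma increment_diff_norm:
  assumes g: "g \<in> L2 m" and h: "h \<in> L2 m"
  shows "(L2_norm Pm (\<lambda>\<omega>. increment g k \<omega> - increment h k \<omega>))\<^sup>2
    = op.defect (\<lambda>x. g x - h x) (\<lambda>x. g x - h x)"
proof -
  have gh: "(\<lambda>x. g x - h x) \<in> L2 m"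
    by (rule L2_diff[OF g h])
  have "AE \<omega> in Pm. increment g k \<omega> - increment h k \<omega> = increment (\<lambda>x. g x - h x) k \<omega>"
    using AE_coord[OF op.diff[OF g h], of "k - 1"]
    by eventually_elim (simp add: increment_def)
  then have "L2_norm Pm (\<lambda>\<omega>. increment g k \<omega> - increment h k \<omega>)
      = L2_norm Pm (increment (\<lambda>x. g x - h x) k)"
    by (intro L2_norm_AE_cong L2_measurable L2_diff increment_L2 g h)
  then show ?thesis
    using increment_norm[OF gh] by (simp add: op.defect_def L2_inner_self)
qed

text \<open>
  The generator of the martingale is the limit of the increments of the averaged solutions at time 0.
  Shifting it gives the limits of the increments at time \<open>k\<close>, which are therefore centred given the
  past. The constant doubles because the limit is reached through the quadratic triangle inequality.
\<close>

lemma limit_increment: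
  assumes f: "f \<in> L2 m" and b: "quad_summable (op.orbit_sq f)"
  obtains Y where "Y \<in> L2 Pm" "Y \<in> borel_measurable (past 0)"
    "\<And>k A. A \<in> sets (past (int k)) \<Longrightarrow> (\<integral>\<omega>\<in>A. Y ((path_shift ^^ Suc k) \<omega>) \<partial>Pm) = 0"
    "\<And>n. 1 \<le> n \<Longrightarrow> (L2_norm Pm (\<lambda>\<omega>. increment (op.poisson_avg f n) 0 \<omega> - Y \<omega>))\<^sup>2
      \<le> 700 * quad_rate (op.orbit_sq f) n"
proof -
  interpret quad_summable "op.orbit_sq f"
    by (rule b)
  let ?R = "quad_rate (op.orbit_sq f)"
  define X where "X n = increment (op.poisson_avg f (Suc n)) 0" for n
  have G: "op.poisson_avg f n \<in> L2 m" for n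
    by (rule op.poisson_avg_L2[OF f])
  have X: "X n \<in> L2 Pm" for n
    unfolding X_def by (rule increment_L2[OF G])
  have dist: "(L2_norm Pm (\<lambda>\<omega>. increment (op.poisson_avg f n) 0 \<omega> - increment (op.poisson_avg f N) 0 \<omega>))\<^sup>2
      \<le> 350 * ?R n" if "1 \<le> n" "n \<le> N" for n N
    unfolding increment_diff_norm[OF G G] by (rule op.defect_poisson_avg_cauchy[OF f b that])
  have "\<exists>N. \<forall>i\<ge>N. \<forall>j\<ge>N. (L2_norm Pm (\<lambda>\<omega>. X i \<omega> - X j \<omega>))\<^sup>2 < e" if e: "e > 0" for e
  proof -
    have "\<forall>\<^sub>F n in sequentially. ?R n < e / 350"
      using e by (intro order_tendstoD(2)[OF quad_rate_tendsto_0]) simp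
    then obtain N where N: "\<And>n. n \<ge> N \<Longrightarrow> ?R n < e / 350"
      by (auto simp: eventually_sequentially)
    have le: "(L2_norm Pm (\<lambda>\<omega>. X i \<omega> - X j \<omega>))\<^sup>2 < e" if "N \<le> i" "i \<le> j" for i j
      using dist[of "Suc i" "Suc j"] N[of "Suc i"] that unfolding X_def by fastforce
    have "(L2_norm Pm (\<lambda>\<omega>. X i \<omega> - X j \<omega>))\<^sup>2 < e" if "N \<le> i" "N \<le> j" for i j
      using le[of i j] le[of j i] that L2_norm_minus_commute[of Pm "X i" "X j"]
      by (cases "i \<le> j") auto
    then show ?thesis
      by blast
  qed
  then obtain Y where Y: "Y \<in> L2 Pm" "Y \<in> borel_measurable (past 0)"
    and lim: "(\<lambda>n. (L2_norm Pm (\<lambda>\<omega>. X n \<omega> - Y \<omega>))\<^sup>2) \<longlonglongrightarrow> 0"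
    using martingale_difference_limit[of X, OF X] increment_adapted[OF G, of _ 0]
    unfolding X_def by blast
  have centred: "(\<integral>\<omega>\<in>A. Y ((path_shift ^^ Suc k) \<omega>) \<partial>Pm) = 0" if A: "A \<in> sets (past (int k))" for k A
  proof -
    define X' Y' where "X' n \<omega> = X n ((path_shift ^^ Suc k) \<omega>)"
      and "Y' \<omega> = Y ((path_shift ^^ Suc k) \<omega>)" for n \<omega>
    have X': "X' n = increment (op.poisson_avg f (Suc n)) (int k + 1)" for n
      by (simp add: X'_def X_def increment_shift fun_eq_iff add.commute del: funpow.simps)
    have L2: "X' n \<in> L2 Pm" "Y' \<in> L2 Pm" for n
      unfolding X'_def[abs_def] Y'_def[abs_def] by (intro L2_shift(1) X Y)+
    have "L2_norm Pm (\<lambda>\<omega>. X' n \<omega> - Y' \<omega>) = L2_norm Pm (\<lambda>\<omega>. X n \<omega> - Y \<omega>)" for n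
      unfolding X'_def Y'_def by (rule L2_shift(2)[OF L2_diff[OF X Y(1)]])
    then have "(\<lambda>n. (L2_norm Pm (\<lambda>\<omega>. X' n \<omega> - Y' \<omega>))\<^sup>2) \<longlonglongrightarrow> 0"
      using lim by simp
    moreover have "(\<integral>\<omega>\<in>A. X' n \<omega> \<partial>Pm) = 0" for n
      unfolding X' using A by (intro increment_centred G) simp
    moreover have "A \<in> sets Pm"
      using A past_subset by auto
    ultimately have "(\<integral>\<omega>\<in>A. Y' \<omega> \<partial>Pm) = 0"
      using L2 by (intro centred_limit[of X' Y'])
    then show ?thesis
      by (simp only: Y'_def)
  qed
  have "(L2_norm Pm (\<lambda>\<omega>. increment (op.poisson_avg f n) 0 \<omega> - Y \<omega>))\<^sup>2 \<le> 700 * ?R n" if n: "1 \<le> n" for n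
  proof (rule tendsto_lowerbound)
    have "(\<lambda>N. 700 * ?R n + 2 * (L2_norm Pm (\<lambda>\<omega>. X N \<omega> - Y \<omega>))\<^sup>2) \<longlonglongrightarrow> 700 * ?R n + 2 * 0"
      by (intro tendsto_intros lim)
    then show "(\<lambda>N. 700 * ?R n + 2 * (L2_norm Pm (\<lambda>\<omega>. X N \<omega> - Y \<omega>))\<^sup>2) \<longlonglongrightarrow> 700 * ?R n"
      by simp
    show "\<forall>\<^sub>F N in sequentially. (L2_norm Pm (\<lambda>\<omega>. increment (op.poisson_avg f n) 0 \<omega> - Y \<omega>))\<^sup>2
        \<le> 700 * ?R n + 2 * (L2_norm Pm (\<lambda>\<omega>. X N \<omega> - Y \<omega>))\<^sup>2"
      using eventually_ge_at_top[of n]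
    proof eventually_elim
      case (elim N)
      show ?case
        using L2_norm_triangle_sq[OF increment_L2[OF G] X Y(1), of n 0 N] dist[OF n, of "Suc N"] elim
        by (simp add: X_def)
    qed
  qed simp
  with Y centred that show ?thesis
    by blast
qed

text \<open>
  \<open>S\<^sub>n\<close> splits into the martingale of the increments of \<open>G\<^sub>n\<close>, the boundary terms of the telescoping
  sum, and the residual \<open>U\<^sub>n(f) / n\<close> summed along the chain.
\<close>

lemma partial_sum_decomposition:
  assumes f: "f \<in> L2 m" and n: "1 \<le> n"
  defines "g \<equiv> op.poisson_avg f n"
  shows "AE \<omega> in Pm. partial_sum (\<lambda>k \<omega>. f (\<omega> (int k))) n \<omega>
    = (\<Sum>k=1..n. increment g (int k) \<omega>)
      + (markov_operator K g (\<omega> 0) - markov_operator K g (\<omega> (int n)))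
      + (\<Sum>k=1..n. U K f n (\<omega> (int k)) / real n)"
proof -
  have "AE x in m. f x = g x - markov_operator K g x + U K f n x / real n"
    using op.poisson_avg_residual[OF f n] unfolding g_def orbit_sum_eq_U by eventually_elim simp
  then have "AE \<omega> in Pm. \<forall>k. f (\<omega> (int k))
      = g (\<omega> (int k)) - markov_operator K g (\<omega> (int k)) + U K f n (\<omega> (int k)) / real n"
    unfolding AE_all_countable using AE_coord[where Q = "\<lambda>x. f x = g x - markov_operator K g x + U K f n x / real n"]
    by blast
  then show ?thesis
  proof eventually_elim
    case (elim \<omega>)
    have "(\<Sum>k=1..j. f (\<omega> (int k))) = (\<Sum>k=1..j. increment g (int k) \<omega>)
        + (markov_operator K g (\<omega> 0) - markov_operator K g (\<omega> (int j)))
        + (\<Sum>k=1..j. U K f n (\<omega> (int k)) / real n)" for j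
    proof (induction j)
      case (Suc j)
      have "f (\<omega> (int (Suc j))) = g (\<omega> (int (Suc j))) - markov_operator K g (\<omega> (int (Suc j)))
          + U K f n (\<omega> (int (Suc j))) / real n"
        using elim by blast
      moreover have "increment g (int (Suc j)) \<omega> = g (\<omega> (int (Suc j))) - markov_operator K g (\<omega> (int j))"
        by (simp add: increment_def)
      ultimately show ?case
        using Suc.IH by (simp only: sum.cl_ivl_Suc) simp
    qed simp
    then show ?case
      by (simp add: partial_sum_def)
  qed
qed

text \<open>
  After \<open>M\<^sub>n\<close> is subtracted, the three parts of the decomposition have squared norms at most \<open>700\<close>, \<open>4\<close> and \<open>4\<close> times
  \<open>n R(n)\<close>; adding them with the quadratic triangle inequality gives
  \<open>2824 = 4 \<cdot> 700 + 4 \<cdot> 4 + 2 \<cdot> 4\<close>. For the martingale part orthogonality is essential: it makes the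
  squared error grow like \<open>n\<close> and not like \<open>n\<^sup>2\<close>.
\<close>

lemma martingale_approximation_bound:
  assumes f: "f \<in> L2 m" and b: "quad_summable (\<lambda>k. (L2_norm m (U K f k))\<^sup>2)"
  obtains Y where "Y \<in> L2 Pm" "is_martingale Pm (\<lambda>n. past (int n)) (shift_sum path_shift Y)"
    "\<And>n. 1 \<le> n \<Longrightarrow> (L2_norm Pm (\<lambda>\<omega>. partial_sum (\<lambda>k \<omega>. f (\<omega> (int k))) n \<omega> - shift_sum path_shift Y n \<omega>))\<^sup>2
      \<le> 2824 * (real n * quad_rate (\<lambda>k. (L2_norm m (U K f k))\<^sup>2) n)"
proof -
  let ?b = "\<lambda>k. (L2_norm m (U K f k))\<^sup>2"
  interpret quad_summable ?b
    by (rule b)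
  let ?R = "quad_rate ?b"
  have b': "quad_summable (op.orbit_sq f)"
    unfolding orbit_sum_eq_U by (rule b)
  obtain Y where Y: "Y \<in> L2 Pm" "Y \<in> borel_measurable (past 0)"
    and centred: "\<And>k A. A \<in> sets (past (int k)) \<Longrightarrow> (\<integral>\<omega>\<in>A. Y ((path_shift ^^ Suc k) \<omega>) \<partial>Pm) = 0"
    and near: "\<And>n. 1 \<le> n \<Longrightarrow> (L2_norm Pm (\<lambda>\<omega>. increment (op.poisson_avg f n) 0 \<omega> - Y \<omega>))\<^sup>2 \<le> 700 * ?R n"
    using limit_increment[OF f b'] unfolding orbit_sum_eq_U by blast
  have "(L2_norm Pm (\<lambda>\<omega>. partial_sum (\<lambda>k \<omega>. f (\<omega> (int k))) n \<omega> - shift_sum path_shift Y n \<omega>))\<^sup>2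
      \<le> 2824 * (real n * ?R n)" if n: "1 \<le> n" for n
  proof -
    define g where "g = op.poisson_avg f n"
    let ?Pg = "markov_operator K g"
    have g: "g \<in> L2 m" and Pg: "?Pg \<in> L2 m" and Un: "U K f n \<in> L2 m"
      unfolding g_def using op.orbit_sum_L2[OF f, of n]
      by (auto simp: orbit_sum_eq_U intro!: op.poisson_avg_L2 op.maps f)
    have avg: "quad_avg ?b n \<le> ?R n"
      by (rule quad_avg_le_rate) (use n in auto)
    define D where "D k \<omega> = increment g (int k) \<omega> - Y ((path_shift ^^ k) \<omega>)" for k \<omega>
    define V where "V \<omega> = ?Pg (\<omega> 0) - ?Pg (\<omega> (int n))" for \<omega> :: "int \<Rightarrow> 'a"
    define E where "E \<omega> = (\<Sum>k=1..n. U K f n (\<omega> (int k)) / real n)" for \<omega> :: "int \<Rightarrow> 'a"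
    have D: "D k \<in> L2 Pm" for k
      unfolding D_def[abs_def] by (intro L2_diff increment_L2 g L2_shift(1) Y)
    have V: "V \<in> L2 Pm"
      unfolding V_def[abs_def] by (intro L2_diff L2_coord Pg)
    have E: "E \<in> L2 Pm"
      unfolding E_def[abs_def] by (intro L2_sum L2_divide L2_coord Un)
    have D_norm: "(L2_norm Pm (D k))\<^sup>2 \<le> 700 * ?R n" for k
    proof -
      have "D k = (\<lambda>\<omega>. (\<lambda>\<omega>. increment g 0 \<omega> - Y \<omega>) ((path_shift ^^ k) \<omega>))"
        by (simp add: D_def increment_shift fun_eq_iff)
      then have "L2_norm Pm (D k) = L2_norm Pm (\<lambda>\<omega>. increment g 0 \<omega> - Y \<omega>)"
        using L2_shift(2)[OF L2_diff[OF increment_L2[OF g] Y(1)]] by simp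
      then show ?thesis
        using near[OF n] by (simp add: g_def)
    qed
    have "(L2_norm Pm (\<lambda>\<omega>. \<Sum>k=1..n. D k \<omega>))\<^sup>2 = (\<Sum>k=1..n. (L2_norm Pm (D k))\<^sup>2)"
    proof (rule Pm.sum_orthogonal_sq[where F = "\<lambda>k. past (int k)"])
      show "D k \<in> borel_measurable (past (int k))" for k
        unfolding D_def[abs_def]
        using measurable_compose[OF measurable_funpow_path_shift_past[of k 0] Y(2)]
        by (intro borel_measurable_diff increment_adapted g) simp
      fix k A assume A: "A \<in> sets (past (int k))"
      have AP: "A \<in> sets Pm"
        using A past_subset by auto
      have "(\<integral>\<omega>\<in>A. increment g (int (Suc k)) \<omega> \<partial>Pm) = 0"
        by (rule increment_centred[OF g]) (use A in simp)
      moreover have "set_integrable Pm A (increment g (int (Suc k)))"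
        "set_integrable Pm A (\<lambda>\<omega>. Y ((path_shift ^^ Suc k) \<omega>))"
        unfolding set_integrable_def
        by (intro integrable_mult_indicator AP Pm.L2_integrable increment_L2 L2_shift(1) Y g)+
      ultimately show "(\<integral>\<omega>\<in>A. D (Suc k) \<omega> \<partial>Pm) = 0"
        unfolding D_def using centred[OF A] by (subst set_integral_diff) auto
    next
      show "sets (past (int i)) \<subseteq> sets (past (int j))" if "i \<le> j" for i j
        using that by (intro past_mono) simp
    qed (rule subalgebra_past D)+
    also have "\<dots> \<le> (\<Sum>k=1..n. 700 * ?R n)"
      by (intro sum_mono D_norm)
    finally have D_sum: "(L2_norm Pm (\<lambda>\<omega>. \<Sum>k=1..n. D k \<omega>))\<^sup>2 \<le> 700 * (real n * ?R n)"
      by simp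
    have "L2_norm m ?Pg = L2_norm m (\<lambda>x. (\<Sum>k=1..n. U K f k x) / real n)"
      using op.T_poisson_avg[OF f n] unfolding g_def orbit_sum_eq_U
      by (intro L2_norm_AE_cong)
        (auto intro!: L2_measurable op.maps op.poisson_avg_L2 f L2_divide L2_sum simp: op.orbit_sum_L2[OF f, unfolded orbit_sum_eq_U])
    then have "(L2_norm m ?Pg)\<^sup>2 = (L2_norm m (\<lambda>x. \<Sum>k=1..n. U K f k x))\<^sup>2 / (real n)\<^sup>2"
      by (simp add: L2_norm_divide_sq)
    also have "\<dots> \<le> (real n * (\<Sum>k=1..n. ?b k)) / (real n)\<^sup>2"
      using L2_norm_sum_sq_le[of "{1..n}" "U K f" m] op.orbit_sum_L2[OF f]
      by (intro divide_right_mono) (auto simp: orbit_sum_eq_U)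
    also have "\<dots> = real n * quad_avg ?b n"
      by (simp add: quad_avg_def)
    also have "\<dots> \<le> real n * ?R n"
      using avg by (intro mult_left_mono) auto
    finally have V_norm: "(L2_norm Pm V)\<^sup>2 \<le> 4 * (real n * ?R n)"
      using L2_norm_diff_sq_le[OF L2_coord(1)[OF Pg] L2_coord(1)[OF Pg], of 0 "int n"]
      by (simp add: V_def[abs_def] L2_coord(2)[OF Pg])
    have "(L2_norm Pm E)\<^sup>2 \<le> real (card {1..n}) * (\<Sum>k=1..n. (L2_norm Pm (\<lambda>\<omega>. U K f n (\<omega> (int k)) / real n))\<^sup>2)"
      unfolding E_def[abs_def] by (rule L2_norm_sum_sq_le) (intro L2_divide L2_coord Un)
    also have "\<dots> = ?b n"
      unfolding L2_norm_divide_sq L2_coord(2)[OF Un] using n by (simp add: power2_eq_square)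
    also have "\<dots> \<le> 4 * real n * quad_avg ?b n"
      using op.orbit_sum_sq_le[OF f, of n] by (simp add: orbit_sum_eq_U)
    also have "\<dots> \<le> 4 * (real n * ?R n)"
      using avg by (simp add: mult_left_mono)
    finally have E_norm: "(L2_norm Pm E)\<^sup>2 \<le> 4 * (real n * ?R n)" .
    have SD: "(\<lambda>\<omega>. \<Sum>k=1..n. D k \<omega>) \<in> L2 Pm"
      by (intro L2_sum D)
    have "AE \<omega> in Pm. partial_sum (\<lambda>k \<omega>. f (\<omega> (int k))) n \<omega> - shift_sum path_shift Y n \<omega>
        = (\<Sum>k=1..n. D k \<omega>) + V \<omega> + E \<omega>"
      using partial_sum_decomposition[OF f n]
      by eventually_elim (simp add: shift_sum_def D_def V_def E_def g_def sum_subtractf)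
    then have "L2_norm Pm (\<lambda>\<omega>. partial_sum (\<lambda>k \<omega>. f (\<omega> (int k))) n \<omega> - shift_sum path_shift Y n \<omega>)
        = L2_norm Pm (\<lambda>\<omega>. (\<Sum>k=1..n. D k \<omega>) + V \<omega> + E \<omega>)"
      unfolding partial_sum_def shift_sum_def
      by (intro L2_norm_AE_cong L2_measurable L2_diff L2_add L2_sum L2_coord L2_shift(1) D V E f Y)
    also have "\<dots>\<^sup>2 \<le> 2 * (2 * (L2_norm Pm (\<lambda>\<omega>. \<Sum>k=1..n. D k \<omega>))\<^sup>2 + 2 * (L2_norm Pm V)\<^sup>2)
        + 2 * (L2_norm Pm E)\<^sup>2"
      using L2_norm_add_sq_le[OF L2_add[OF SD V] E] L2_norm_add_sq_le[OF SD V] by simp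
    also have "\<dots> \<le> 2824 * (real n * ?R n)"
      using D_sum V_norm E_norm by argo
    finally show ?thesis .
  qed
  then show ?thesis
    using that[OF Y(1) is_martingale_shift_sum[OF Y centred]] by blast
qed

end

theorem proposition6p1:
  fixes m :: "'a measure" and K :: "'a \<Rightarrow> 'a measure" and Pm :: "(int \<Rightarrow> 'a) measure"
    and f :: "'a \<Rightarrow> real"
  assumes chain: "ergodic_markov_chain m K Pm"
    and normal: "L2_normal m (markov_operator K)"
    and f: "f \<in> L2 m"
    and summable: "summable (\<lambda>n. (L2_norm m (U K f (Suc n)))\<^sup>2 / (real (Suc n))\<^sup>2)"
  shows "\<exists>M. martingale_approximation Pm (\<lambda>n. natural_filtration m (int n)) path_shift
               (\<lambda>n \<omega>. f (\<omega> (int n))) M \<and>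
             (\<exists>C>0. \<forall>n\<ge>1.
               1 / real n * (L2_norm Pm (\<lambda>\<omega>. partial_sum (\<lambda>k \<omega>. f (\<omega> (int k))) n \<omega>
                                              - shift_sum path_shift M n \<omega>))\<^sup>2
               \<le> C * (1 / real n * (\<Sum>k=1..n. (L2_norm m (U K f k))\<^sup>2 / real k)
                      + (\<Sum>j. (L2_norm m (U K f (j + (n + 1))))\<^sup>2 / (real (j + (n + 1)))\<^sup>2)))"
proof -
  interpret ergodic_markov_chain m K Pm
    by (rule chain)
  interpret op: normal_L2_contraction m "markov_operator K"
    by (rule normal_L2_contraction_markov_operator[OF normal])
  interpret normal_stationary_chain m K Pm ..
  let ?b = "\<lambda>k. (L2_norm m (U K f k))\<^sup>2"
  interpret quad_summable ?b
    by unfold_locales (simp, rule summable)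
  let ?err = "\<lambda>M n. L2_norm Pm (\<lambda>\<omega>. partial_sum (\<lambda>k \<omega>. f (\<omega> (int k))) n \<omega> - shift_sum path_shift M n \<omega>)"
  obtain M where M: "M \<in> L2 Pm" "is_martingale Pm (\<lambda>n. past (int n)) (shift_sum path_shift M)"
    and bound: "\<And>n. 1 \<le> n \<Longrightarrow> (?err M n)\<^sup>2 \<le> 2824 * (real n * quad_rate ?b n)"
    using martingale_approximation_bound[OF f quad_summable_axioms] by blast
  have "(\<lambda>n. ?err M n / sqrt (real n)) \<longlonglongrightarrow> 0"
  proof (rule tendsto_sandwich[OF _ _ tendsto_const])
    have "(\<lambda>n. sqrt (2824 * quad_rate ?b n)) \<longlonglongrightarrow> sqrt (2824 * 0)"
      by (intro tendsto_intros quad_rate_tendsto_0)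
    then show "(\<lambda>n. sqrt (2824 * quad_rate ?b n)) \<longlonglongrightarrow> 0"
      by simp
    show "\<forall>\<^sub>F n in sequentially. ?err M n / sqrt (real n) \<le> sqrt (2824 * quad_rate ?b n)"
      using eventually_ge_at_top[of 1]
    proof eventually_elim
      case (elim n)
      have "?err M n \<le> sqrt (2824 * (real n * quad_rate ?b n))"
        by (rule real_le_rsqrt[OF bound[OF elim]])
      also have "\<dots> = sqrt (2824 * quad_rate ?b n) * sqrt (real n)"
        by (simp add: real_sqrt_mult)
      finally show ?case
        using elim by (simp add: pos_divide_le_eq)
    qed
  qed simp
  then have "?err M \<in> o(\<lambda>n. sqrt (real n))"
    by (rule smalloI_tendsto) (use eventually_gt_at_top[of 0] in eventually_elim, simp)
  then have "martingale_approximation Pm (\<lambda>n. natural_filtration m (int n)) path_shift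
      (\<lambda>n \<omega>. f (\<omega> (int n))) M"
    using M by (simp add: martingale_approximation_def)
  moreover have "1 / real n * (?err M n)\<^sup>2
      \<le> 2824 * (1 / real n * (\<Sum>k=1..n. ?b k / real k)
        + (\<Sum>j. ?b (j + (n + 1)) / (real (j + (n + 1)))\<^sup>2))" if n: "1 \<le> n" for n
  proof -
    have "quad_avg ?b n = 1 / real n * (\<Sum>k=1..n. ?b k / real n)"
      by (simp add: quad_avg_def sum_divide_distrib[symmetric] power2_eq_square)
    also have "\<dots> \<le> 1 / real n * (\<Sum>k=1..n. ?b k / real k)"
      by (intro mult_left_mono sum_mono divide_left_mono) auto
    finally have avg: "quad_avg ?b n \<le> 1 / real n * (\<Sum>k=1..n. ?b k / real k)" .
    have "1 / real n * (?err M n)\<^sup>2 \<le> 1 / real n * (2824 * (real n * quad_rate ?b n))"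
      by (intro mult_left_mono bound n) simp
    also have "\<dots> = 2824 * quad_rate ?b n"
      using n by simp
    also have "\<dots> \<le> 2824 * (1 / real n * (\<Sum>k=1..n. ?b k / real k) + quad_tail ?b n)"
      unfolding quad_rate_def using avg by simp
    finally show ?thesis
      by (simp only: quad_tail_def)
  qed
  ultimately show ?thesis
    by (intro exI[of _ M] conjI exI[of _ "2824 :: real"]) auto
qed

end
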